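(* Let $(\Lambda V,d)$ be a Sullivan minimal algebra over $\mathbb{Q}$ with $V=V^{\ge2}$ and $\dim V<\infty$. Write $d=\sum_{i\ge k}d_i$ with $d_i(V)\subseteq\Lambda^iV$ and $d_k\ne0$ the first non-zero term. Then $$\mathrm{r}(\Lambda V,d)=\mathrm{r}(\Lambda V,d_k).$$ As a particular case, for the associated pure algebra $(\Lambda V,d_\sigma)$, written $d_\sigma=\sum_{i\ge k}d_{\sigma,i}$ with $d_{\sigma,i}(V)\subseteq\Lambda^iV$ and $d_{\sigma,k}$ the first non-zero term of $d_\sigma$ (here $k$ refers to $d_\sigma$), one has $$\mathrm{r}(\Lambda V,d_\sigma)=\mathrm{r}(\Lambda V,d_{\sigma,k}).$$
   Context: Each $d_i$ is extended to $\Lambda V$ as a derivation. The pure differential $d_\sigma$ associated with $d$ is the derivation determined by $d_\sigma(V^{even})=0$, $d_\sigma(V^{odd})\subseteq\Lambda V^{even}$ and $(d-d_\sigma)(V^{odd})\subseteq\Lambda V^{even}\otimes\Lambda^+V^{odd}$. $\mathrm{r}(\Lambda V,d)$: let $(\Lambda V\otimes\Gamma(sV),D)$ be the acyclic closure of $(\Lambda V,d)$: $\Gamma(sV)$ is the divided power algebra on the suspension $sV$, $D$ is a $\Gamma$-derivation extending $d$ (so $D(\gamma^p(sv))=D(sv)\gamma^{p-1}(sv)$) with $D(sv)=v+s(dv)$, where $s(dv)$ denotes a term in $\Lambda^{+}V\otimes\Gamma^{+}(sV)$ making $D^2=0$; it is a $(\Lambda V,d)$-semifree resolution of $\mathbb{Q}$.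 The complex $\mathrm{Hom}_{\Lambda V}(\Lambda V\otimes\Gamma(sV),\Lambda V)$, with differential $\mathcal{D}(f)=d\circ f+(-1)^{|f|+1}f\circ D$, computes the differential Ext $\mathcal{E}xt_{(\Lambda V,d)}(\mathbb{Q},(\Lambda V,d))$ of Eilenberg–Moore. It is filtered by $\mathcal{F}^p=\{f\mid f(\Gamma(sV))\subseteq\Lambda^{\ge p}V\}$, and $\mathrm{r}(\Lambda V,d)=\sup\{p\in\mathbb{N}\mid\mathcal{E}_\infty^{p,*}\ne0\}$ for the induced spectral sequence converging to $\mathcal{E}xt_{(\Lambda V,d)}(\mathbb{Q},(\Lambda V,d))$, or $\infty$ if such $p$ does not exist. The same definition applies with $d$ replaced by $d_k$, $d_\sigma$, $d_{\sigma,k}$. *)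

theory Defs
  imports Complex_Main "HOL-Library.Poly_Mapping" "HOL-Library.Extended_Nat"
begin

text \<open>
  A finite-dimensional graded rational vector space with a chosen ordered homogeneous basis
  \<open>v\<^sub>0, \<dots>, v\<^sub>n\<^sub>-\<^sub>1\<close> is encoded by the list \<open>V\<close> of the degrees of the basis elements.
  A monomial is its exponent function; it stands for the product \<open>v\<^sub>0^(m 0) \<cdots> v\<^sub>n\<^sub>-\<^sub>1^(m (n-1))\<close>
  in the free graded-commutative algebra, and for the product of divided powers
  \<open>\<gamma>^(m 0)(sv\<^sub>0) \<cdots> \<gamma>^(m (n-1))(sv\<^sub>n\<^sub>-\<^sub>1)\<close> in the divided power algebra on the suspension.
\<close>

type_synonym mono = "nat \<Rightarrow> nat"
type_synonym lam = "mono \<Rightarrow>\<^sub>0 rat"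
type_synonym lamgam = "(mono \<times> mono) \<Rightarrow>\<^sub>0 rat"

definition mons :: "nat list \<Rightarrow> mono set" where
  "mons V = {m. (\<forall>i. length V \<le> i \<longrightarrow> m i = 0) \<and> (\<forall>i<length V. odd (V ! i) \<longrightarrow> m i \<le> 1)}"

definition mdeg :: "nat list \<Rightarrow> mono \<Rightarrow> nat" where
  "mdeg V m = (\<Sum>i<length V. m i * V ! i)"

definition wlen :: "nat list \<Rightarrow> mono \<Rightarrow> nat" where
  "wlen V m = (\<Sum>i<length V. m i)"

definition mpow :: "nat \<Rightarrow> nat \<Rightarrow> mono" where
  "mpow i p = (\<lambda>j. if j = i then p else 0)"

definition mone :: mono where
  "mone = (\<lambda>_. 0)"

definition madd :: "mono \<Rightarrow> mono \<Rightarrow> mono" where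
  "madd m m' = (\<lambda>i. m i + m' i)"

text \<open>Suspension: \<open>(sV)^j = V^(j+1)\<close>.\<close>

definition susp :: "nat list \<Rightarrow> nat list" where
  "susp V = map (\<lambda>k. k - 1) V"


section \<open>The algebras \<open>\<Lambda>V\<close>, \<open>\<Gamma>(sV)\<close> and \<open>\<Lambda>V \<otimes> \<Gamma>(sV)\<close>\<close>

definition scal :: "rat \<Rightarrow> ('m \<Rightarrow>\<^sub>0 rat) \<Rightarrow> ('m \<Rightarrow>\<^sub>0 rat)" where
  "scal c a = Poly_Mapping.map ((*) c) a"

definition bilin :: "('m \<Rightarrow> 'm \<Rightarrow> 'm) \<Rightarrow> ('m \<Rightarrow> 'm \<Rightarrow> rat) \<Rightarrow>
    ('m \<Rightarrow>\<^sub>0 rat) \<Rightarrow> ('m \<Rightarrow>\<^sub>0 rat) \<Rightarrow> ('m \<Rightarrow>\<^sub>0 rat)" where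
  "bilin s c a b = (\<Sum>x\<in>Poly_Mapping.keys a. \<Sum>y\<in>Poly_Mapping.keys b.
     Poly_Mapping.single (s x y) (c x y * Poly_Mapping.lookup a x * Poly_Mapping.lookup b y))"

text \<open>
  Structure constant of \<open>\<Lambda>V\<close>: the Koszul sign for moving each factor \<open>v\<^sub>i\<close> of the second
  monomial to the left past the factors \<open>v\<^sub>j\<close>, \<open>j > i\<close>, of the first one; the product vanishes
  if an odd generator would be repeated.
\<close>

definition lam_coeff :: "nat list \<Rightarrow> mono \<Rightarrow> mono \<Rightarrow> rat" where
  "lam_coeff V m m' = (if madd m m' \<in> mons V
     then (-1) ^ (\<Sum>j<length V. \<Sum>i<j. (m j * V ! j) * (m' i * V ! i)) else 0)"

text \<open>In \<open>\<Gamma>(sV)\<close> one has \<open>\<gamma>^p(x) \<gamma>^q(x) = (p+q choose p) \<gamma>^(p+q)(x)\<close> for \<open>x\<close> of even degree.\<close>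

definition gam_coeff :: "nat list \<Rightarrow> mono \<Rightarrow> mono \<Rightarrow> rat" where
  "gam_coeff V g g' = lam_coeff (susp V) g g' * (\<Prod>i<length V. of_nat ((g i + g' i) choose g i))"

text \<open>\<open>(a \<otimes> g)(a' \<otimes> g') = (-1)^(|g| |a'|) aa' \<otimes> gg'\<close>\<close>

definition lamgam_coeff :: "nat list \<Rightarrow> mono \<times> mono \<Rightarrow> mono \<times> mono \<Rightarrow> rat" where
  "lamgam_coeff V x y = (-1) ^ (mdeg (susp V) (snd x) * mdeg V (fst y))
     * lam_coeff V (fst x) (fst y) * gam_coeff V (snd x) (snd y)"

definition Lam :: "nat list \<Rightarrow> lam set" where
  "Lam V = {a. Poly_Mapping.keys a \<subseteq> mons V}"

definition Gam :: "nat list \<Rightarrow> lam set" where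
  "Gam V = {b. Poly_Mapping.keys b \<subseteq> mons (susp V)}"

definition LamGam :: "nat list \<Rightarrow> lamgam set" where
  "LamGam V = {x. Poly_Mapping.keys x \<subseteq> mons V \<times> mons (susp V)}"

definition lmult :: "nat list \<Rightarrow> lam \<Rightarrow> lam \<Rightarrow> lam" where
  "lmult V = bilin madd (lam_coeff V)"

definition pmult :: "nat list \<Rightarrow> lamgam \<Rightarrow> lamgam \<Rightarrow> lamgam" where
  "pmult V = bilin (\<lambda>x y. (madd (fst x) (fst y), madd (snd x) (snd y))) (lamgam_coeff V)"

definition tens :: "lam \<Rightarrow> lam \<Rightarrow> lamgam" where
  "tens a b = (\<Sum>m\<in>Poly_Mapping.keys a. \<Sum>g\<in>Poly_Mapping.keys b.
     Poly_Mapping.single (m, g) (Poly_Mapping.lookup a m * Poly_Mapping.lookup b g))"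

definition lone :: lam where
  "lone = Poly_Mapping.single mone 1"

text \<open>\<open>gen i\<close> is \<open>v\<^sub>i\<close> in \<open>\<Lambda>V\<close>; \<open>dpow i p\<close> is \<open>\<gamma>^p(sv\<^sub>i)\<close> in \<open>\<Gamma>(sV)\<close>, so \<open>dpow i 1\<close> is \<open>sv\<^sub>i\<close>.\<close>

definition gen :: "nat \<Rightarrow> lam" where
  "gen i = Poly_Mapping.single (mpow i 1) 1"

definition dpow :: "nat \<Rightarrow> nat \<Rightarrow> lam" where
  "dpow i p = Poly_Mapping.single (mpow i p) 1"

text \<open>Homogeneity; zero is homogeneous of every degree.\<close>

definition lhomog :: "nat list \<Rightarrow> int \<Rightarrow> lam \<Rightarrow> bool" where
  "lhomog V j a \<longleftrightarrow> (\<forall>m\<in>Poly_Mapping.keys a. int (mdeg V m) = j)"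

definition phomog :: "nat list \<Rightarrow> int \<Rightarrow> lamgam \<Rightarrow> bool" where
  "phomog V j x \<longleftrightarrow>
     (\<forall>(m, g)\<in>Poly_Mapping.keys x. int (mdeg V m) + int (mdeg (susp V) g) = j)"

definition Lam_ge :: "nat list \<Rightarrow> int \<Rightarrow> lam set" where
  "Lam_ge V p = {a \<in> Lam V. \<forall>m\<in>Poly_Mapping.keys a. p \<le> int (wlen V m)}"

definition wpart :: "nat list \<Rightarrow> nat \<Rightarrow> lam \<Rightarrow> lam" where
  "wpart V i a = (\<Sum>m\<in>{m \<in> Poly_Mapping.keys a. wlen V m = i}.
     Poly_Mapping.single m (Poly_Mapping.lookup a m))"

definition linear_between ::
    "('m \<Rightarrow>\<^sub>0 rat) set \<Rightarrow> ('k \<Rightarrow>\<^sub>0 rat) set \<Rightarrow> (('m \<Rightarrow>\<^sub>0 rat) \<Rightarrow> ('k \<Rightarrow>\<^sub>0 rat)) \<Rightarrow> bool" where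
  "linear_between A B f \<longleftrightarrow> (\<forall>x\<in>A. f x \<in> B) \<and> (\<forall>x\<in>A. \<forall>y\<in>A. f (x + y) = f x + f y)
     \<and> (\<forall>c. \<forall>x\<in>A. f (scal c x) = scal c (f x))"


section \<open>Minimal Sullivan algebras and derived differentials\<close>

text \<open>Derivations of degree \<open>+1\<close>.\<close>

definition derivation :: "nat list \<Rightarrow> (lam \<Rightarrow> lam) \<Rightarrow> bool" where
  "derivation V d \<longleftrightarrow> linear_between (Lam V) (Lam V) d
     \<and> (\<forall>a\<in>Lam V. \<forall>j. lhomog V j a \<longrightarrow> lhomog V (j + 1) (d a))
     \<and> (\<forall>a\<in>Lam V. \<forall>b\<in>Lam V. \<forall>j. lhomog V j a \<longrightarrow>
          d (lmult V a b) = lmult V (d a) b + scal ((-1) powi j) (lmult V a (d b)))"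

text \<open>
  The basis is indexed compatibly with the nilpotence condition:
  \<open>dv\<^sub>i \<in> \<Lambda>(v\<^sub>0, \<dots>, v\<^sub>i\<^sub>-\<^sub>1)\<close>. Minimality is \<open>dV \<subseteq> \<Lambda>^(\<ge>2)V\<close>.
\<close>

definition sullivan_minimal :: "nat list \<Rightarrow> (lam \<Rightarrow> lam) \<Rightarrow> bool" where
  "sullivan_minimal V d \<longleftrightarrow> (\<forall>k\<in>set V. 1 \<le> k) \<and> derivation V d
     \<and> (\<forall>a\<in>Lam V. d (d a) = 0)
     \<and> (\<forall>i<length V. \<forall>m\<in>Poly_Mapping.keys (d (gen i)). \<forall>j\<ge>i. m j = 0)
     \<and> (\<forall>i<length V. d (gen i) \<in> Lam_ge V 2)"

text \<open>\<open>word_term V d i e\<close>: \<open>e\<close> is the term \<open>d\<^sub>i\<close>, extended from \<open>V\<close> to \<open>\<Lambda>V\<close> as a derivation.\<close>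

definition word_term :: "nat list \<Rightarrow> (lam \<Rightarrow> lam) \<Rightarrow> nat \<Rightarrow> (lam \<Rightarrow> lam) \<Rightarrow> bool" where
  "word_term V d i e \<longleftrightarrow> derivation V e \<and> (\<forall>j<length V. e (gen j) = wpart V i (d (gen j)))"

definition first_term :: "nat list \<Rightarrow> (lam \<Rightarrow> lam) \<Rightarrow> nat \<Rightarrow> (lam \<Rightarrow> lam) \<Rightarrow> bool" where
  "first_term V d k dk \<longleftrightarrow> word_term V d k dk \<and> (\<exists>j<length V. dk (gen j) \<noteq> 0)
     \<and> (\<forall>i<k. \<forall>j<length V. wpart V i (d (gen j)) = 0)"

definition even_mono :: "nat list \<Rightarrow> mono \<Rightarrow> bool" where
  "even_mono V m \<longleftrightarrow> (\<forall>i<length V. odd (V ! i) \<longrightarrow> m i = 0)"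

definition pure_differential :: "nat list \<Rightarrow> (lam \<Rightarrow> lam) \<Rightarrow> (lam \<Rightarrow> lam) \<Rightarrow> bool" where
  "pure_differential V d ds \<longleftrightarrow> derivation V ds
     \<and> (\<forall>i<length V. even (V ! i) \<longrightarrow> ds (gen i) = 0)
     \<and> (\<forall>i<length V. odd (V ! i) \<longrightarrow>
          (\<forall>m\<in>Poly_Mapping.keys (ds (gen i)). even_mono V m)
        \<and> (\<forall>m\<in>Poly_Mapping.keys (d (gen i) - ds (gen i)). \<not> even_mono V m))"


section \<open>Acyclic closure\<close>

text \<open>
  The divided power condition is stated for those \<open>sv\<^sub>i\<close> of even degree. The conditions
  below make \<open>(\<Lambda>V \<otimes> \<Gamma>(sV), D)\<close> a semifree resolution of the ground field when \<open>V = V^(\<ge>2)\<close>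
  and \<open>d\<close> is minimal: filter by total word length, where the associated graded is the Koszul
  complex.
\<close>

definition acyclic_closure :: "nat list \<Rightarrow> (lam \<Rightarrow> lam) \<Rightarrow> (lamgam \<Rightarrow> lamgam) \<Rightarrow> bool" where
  "acyclic_closure V d D \<longleftrightarrow> linear_between (LamGam V) (LamGam V) D
     \<and> (\<forall>x\<in>LamGam V. \<forall>j. phomog V j x \<longrightarrow> phomog V (j + 1) (D x))
     \<and> (\<forall>x\<in>LamGam V. \<forall>y\<in>LamGam V. \<forall>j. phomog V j x \<longrightarrow>
          D (pmult V x y) = pmult V (D x) y + scal ((-1) powi j) (pmult V x (D y)))
     \<and> (\<forall>a\<in>Lam V. D (tens a lone) = tens (d a) lone)
     \<and> (\<forall>i<length V. odd (V ! i) \<longrightarrow> (\<forall>p\<ge>1. D (tens lone (dpow i p))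
          = pmult V (D (tens lone (dpow i 1))) (tens lone (dpow i (p - 1)))))
     \<and> (\<forall>i<length V. \<forall>(m, g)\<in>Poly_Mapping.keys (D (tens lone (dpow i 1)) - tens (gen i) lone).
          m \<noteq> mone \<and> g \<noteq> mone)
     \<and> (\<forall>x\<in>LamGam V. D (D x) = 0)"


section \<open>The filtered complex and its spectral sequence\<close>

text \<open>
  \<open>Hom_deg V q\<close>: the \<open>\<Lambda>V\<close>-linear maps \<open>\<Lambda>V \<otimes> \<Gamma>(sV) \<rightarrow> \<Lambda>V\<close> of degree \<open>q\<close>. Only values on
  the carrier matter: maps agreeing there differ by an element of every \<open>Filt V p q\<close>.
\<close>

definition Hom_deg :: "nat list \<Rightarrow> int \<Rightarrow> (lamgam \<Rightarrow> lam) set" where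
  "Hom_deg V q = {f. linear_between (LamGam V) (Lam V) f
     \<and> (\<forall>x\<in>LamGam V. \<forall>j. phomog V j x \<longrightarrow> lhomog V (j + q) (f x))
     \<and> (\<forall>a\<in>Lam V. \<forall>x\<in>LamGam V. \<forall>j. lhomog V j a \<longrightarrow>
          f (pmult V (tens a lone) x) = scal ((-1) powi (q * j)) (lmult V a (f x)))}"

text \<open>The differential on maps of degree \<open>q\<close>.\<close>

definition Hom_diff ::
    "(lam \<Rightarrow> lam) \<Rightarrow> (lamgam \<Rightarrow> lamgam) \<Rightarrow> int \<Rightarrow> (lamgam \<Rightarrow> lam) \<Rightarrow> lamgam \<Rightarrow> lam" where
  "Hom_diff d D q f = (\<lambda>x. d (f x) + scal ((-1) powi (q + 1)) (f (D x)))"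

definition Filt :: "nat list \<Rightarrow> int \<Rightarrow> int \<Rightarrow> (lamgam \<Rightarrow> lam) set" where
  "Filt V p q = {f \<in> Hom_deg V q. \<forall>b\<in>Gam V. f (tens lone b) \<in> Lam_ge V p}"

text \<open>
  With \<open>A_r^p = {f \<in> F^p. \<D>f \<in> F^(p+r)}\<close>, the page \<open>E_r^p\<close> is the quotient of the image of
  \<open>A_r^p\<close> by the image of \<open>\<D>(A_(r-1)^(p-r+1))\<close> in \<open>F^p/F^(p+1)\<close>; the limit page is the
  intersection of the former modulo the union of the latter. The sets \<open>Z_inf\<close> and \<open>B_inf\<close> are
  the preimages in \<open>F^p\<close> of this intersection and union.
\<close>

definition approx_cycles :: "nat list \<Rightarrow> (lam \<Rightarrow> lam) \<Rightarrow> (lamgam \<Rightarrow> lamgam) \<Rightarrow>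
    nat \<Rightarrow> int \<Rightarrow> int \<Rightarrow> (lamgam \<Rightarrow> lam) set" where
  "approx_cycles V d D r p q = {f \<in> Filt V p q. Hom_diff d D q f \<in> Filt V (p + int r) (q + 1)}"

definition Z_inf :: "nat list \<Rightarrow> (lam \<Rightarrow> lam) \<Rightarrow> (lamgam \<Rightarrow> lamgam) \<Rightarrow>
    int \<Rightarrow> int \<Rightarrow> (lamgam \<Rightarrow> lam) set" where
  "Z_inf V d D p q = {f \<in> Filt V p q.
     \<forall>r. \<exists>z\<in>approx_cycles V d D r p q. (\<lambda>x. f x - z x) \<in> Filt V (p + 1) q}"

definition B_inf :: "nat list \<Rightarrow> (lam \<Rightarrow> lam) \<Rightarrow> (lamgam \<Rightarrow> lamgam) \<Rightarrow>
    int \<Rightarrow> int \<Rightarrow> (lamgam \<Rightarrow> lam) set" where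
  "B_inf V d D p q = {f \<in> Filt V p q.
     \<exists>r. \<exists>g\<in>approx_cycles V d D r (p - int r) (q - 1).
       (\<lambda>x. f x - Hom_diff d D (q - 1) g x) \<in> Filt V (p + 1) q}"

definition E_inf_nonzero ::
    "nat list \<Rightarrow> (lam \<Rightarrow> lam) \<Rightarrow> (lamgam \<Rightarrow> lamgam) \<Rightarrow> int \<Rightarrow> bool" where
  "E_inf_nonzero V d D p \<longleftrightarrow> (\<exists>q. \<not> Z_inf V d D p q \<subseteq> B_inf V d D p q)"

definition r_inv :: "nat list \<Rightarrow> (lam \<Rightarrow> lam) \<Rightarrow> (lamgam \<Rightarrow> lamgam) \<Rightarrow> enat" where
  "r_inv V d D = (let S = {p::nat. E_inf_nonzero V d D (int p)} in
     if S = {} then \<infinity> else (SUP p\<in>S. enat p))"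

end

theory Submission
  imports Defs
begin

text \<open>
  Both invariants equal the number of odd generators, whatever the differential is. For
  \<open>f \<in> F^p\<close> of fixed degree only finitely many coefficients of word length exactly \<open>p\<close> are
  non-zero, so they can be ordered by word length in \<open>\<Gamma>(sV)\<close>. The top part of \<open>\<D>f\<close> for this
  order, in word length \<open>p + 1\<close>, comes only from the term \<open>v\<close> of \<open>D(sv) = v + s(dv)\<close>: it is the
  Koszul differential of the top part of \<open>f\<close>. The Koszul complex of \<open>Hom(\<Gamma>(sV), \<Lambda>V)\<close> is exact
  except for the class sending the product of the suspended even generators to the product of
  the odd generators, which sits in filtration degree \<open>p = dim V^odd\<close>. Peeling off top parts
  shows that a map \<open>f \<in> F^p\<close> with \<open>\<D>f \<in> F^(p+2)\<close> is a boundary modulo \<open>F^(p+1)\<close> when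
  \<open>p \<noteq> dim V^odd\<close>, so that the second page is concentrated in this single filtration
  degree, and that the exceptional class survives.
\<close>

text \<open>The difficulty is that the Koszul term is not alone in raising word length in
  \<open>\<Lambda>V\<close> by one: a quadratic part of \<open>d\<close> does so too, and it puts
  terms \<open>w \<otimes> sw'\<close> into \<open>s(dv)\<close>. What separates them is total word
  length, which the term \<open>v\<close> of \<open>D(sv)\<close> preserves and every term of
  \<open>s(dv)\<close> increases. Evaluated at a monomial \<open>g\<close> of
  \<open>\<Gamma>(sV)\<close>, the Koszul term involves \<open>f\<close> at monomials one shorter
  than \<open>g\<close>, while the other terms with a single factor from \<open>V\<close> involve
  \<open>f\<close> only at monomials at least as long as \<open>g\<close>. This triangular shape can
  be exploited only from the top, and degrees supply a top: a non-zero coefficient has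
  \<open>|m| = |g| + q\<close>, and \<open>|sv| \<ge> 1\<close>. Divided powers make all Koszul
  coefficients signs, so the contraction is given by explicit signs. No infinite sum of corrections
  occurs either: \<open>Z_inf\<close> asks for an approximate cycle for one \<open>r\<close> at a
  time, and an element of \<open>B_inf\<close> comes with a single \<open>r\<close>, so finitely
  many corrections are enough on both sides.\<close>

abbreviation monom :: "'m \<Rightarrow> rat \<Rightarrow> ('m \<Rightarrow>\<^sub>0 rat)" where
  "monom \<equiv> Poly_Mapping.single"

text \<open>Degrees of maps may be negative, hence the integer exponent; the definition by parity
  turns sign identities into parity computations.\<close>

definition sg :: "int \<Rightarrow> rat" where
  "sg k = (if even k then 1 else -1)"

lemma powi_sg: "(-1) powi k = sg k"
  by (auto simp: sg_def power_int_def minus_one_power_iff even_nat_iff power_inverse)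

lemma power_sg: "(-1) ^ n = sg (int n)"
  by (simp add: sg_def minus_one_power_iff)

lemma sg_add: "sg (a + b) = sg a * sg b"
  by (auto simp: sg_def)

lemma sg_sq [simp]: "sg a * sg a = 1"
  by (auto simp: sg_def)

lemma sg_sq' [simp]: "sg a * (sg a * x) = x"
  by (auto simp: sg_def)

lemma sg_0 [simp]: "sg 0 = 1"
  by (simp add: sg_def)

lemma sg_nz [simp]: "sg a \<noteq> 0"
  by (simp add: sg_def)

section \<open>Formal linear combinations\<close>

lemma lookup_scal [simp]:
  "Poly_Mapping.lookup (scal c a) k = c * Poly_Mapping.lookup a k"
  unfolding scal_def by transfer (simp add: when_def)

lemma scal_add: "scal c (a + b) = scal c a + scal c b"
  by (rule poly_mapping_eqI) (simp add: lookup_add algebra_simps)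

lemma scal_diff: "scal c (a - b) = scal c a - scal c b"
  by (rule poly_mapping_eqI) (simp add: lookup_minus algebra_simps)

lemma scal_add_left: "scal (c + e) a = scal c a + scal e a"
  by (rule poly_mapping_eqI) (simp add: lookup_add algebra_simps)

lemma scal_scal [simp]: "scal c (scal e a) = scal (c * e) a"
  by (rule poly_mapping_eqI) simp

lemma scal_zero [simp]: "scal c 0 = 0" "scal 0 a = 0"
  by (rule poly_mapping_eqI, simp)+

lemma scal_one [simp]: "scal 1 a = a"
  by (rule poly_mapping_eqI) simp

lemma scal_minus_one: "scal (-1) a = - a"
  by (rule poly_mapping_eqI) simp

lemma scal_single [simp]: "scal c (monom k e) = monom k (c * e)"
  by (rule poly_mapping_eqI) (simp add: lookup_single when_def)

lemma keys_scal: "Poly_Mapping.keys (scal c a) \<subseteq> Poly_Mapping.keys a"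
  by (auto simp: in_keys_iff)

lemma scal_sum: "scal c (sum f S) = (\<Sum>s\<in>S. scal c (f s))"
  by (induction S rule: infinite_finite_induct) (auto simp: scal_add)

text \<open>Reduces linear statements to single monomials. Both supports stay inside
  \<open>S\<close>, which supplies the membership conditions of maps that are linear only on a
  carrier.\<close>

lemma keys_linear_induct [consumes 1, case_names zero single add]:
  assumes "Poly_Mapping.keys x \<subseteq> S"
    and "P 0" and "\<And>k c. k \<in> S \<Longrightarrow> P (monom k c)"
    and "\<And>x y. Poly_Mapping.keys x \<subseteq> S \<Longrightarrow> Poly_Mapping.keys y \<subseteq> S \<Longrightarrow> P x \<Longrightarrow> P y \<Longrightarrow> P (x + y)"
  shows "P x"
  using assms(1)
proof (induction x rule: update_induct)
  case const
  show ?case by fact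
next
  case (update f a b)
  have eq: "Poly_Mapping.update a b f = f + monom a b"
    using update(1) by (intro poly_mapping_eqI) (auto simp: lookup_update lookup_add lookup_single when_def in_keys_iff)
  have "Poly_Mapping.keys (Poly_Mapping.update a b f) = insert a (Poly_Mapping.keys f)"
    using update(2) by (simp add: keys_update)
  then show ?case
    unfolding eq using update assms(3,4) by (simp add: eq)
qed

text \<open>Supports of sums shrink under cancellation, so bilinearity is checked over one finite
  index set containing all supports.\<close>

lemma bilin_superset:
  assumes "finite A" "finite B" "Poly_Mapping.keys a \<subseteq> A" "Poly_Mapping.keys b \<subseteq> B"
  shows "bilin s c a b = (\<Sum>x\<in>A. \<Sum>y\<in>B.
     monom (s x y) (c x y * Poly_Mapping.lookup a x * Poly_Mapping.lookup b y))"
proof -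
  have "bilin s c a b = (\<Sum>x\<in>Poly_Mapping.keys a. \<Sum>y\<in>B.
     monom (s x y) (c x y * Poly_Mapping.lookup a x * Poly_Mapping.lookup b y))"
    unfolding bilin_def using assms
    by (intro sum.cong refl sum.mono_neutral_left) (auto simp: in_keys_iff)
  also have "\<dots> = (\<Sum>x\<in>A. \<Sum>y\<in>B.
     monom (s x y) (c x y * Poly_Mapping.lookup a x * Poly_Mapping.lookup b y))"
    using assms by (intro sum.mono_neutral_left) (auto simp: in_keys_iff intro!: sum.neutral)
  finally show ?thesis .
qed

lemma bilin_add_left: "bilin s c (a + a') b = bilin s c a b + bilin s c a' b"
proof -
  let ?A = "Poly_Mapping.keys a \<union> Poly_Mapping.keys a'" and ?B = "Poly_Mapping.keys b"
  have "finite ?A" "finite ?B" by auto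
  then show ?thesis
    using keys_add[of a a']
    by (subst (1 2 3) bilin_superset[of ?A ?B])
       (auto simp: sum.distrib[symmetric] single_add[symmetric] lookup_add algebra_simps)
qed

lemma bilin_add_right: "bilin s c a (b + b') = bilin s c a b + bilin s c a b'"
proof -
  let ?B = "Poly_Mapping.keys b \<union> Poly_Mapping.keys b'" and ?A = "Poly_Mapping.keys a"
  have "finite ?A" "finite ?B" by auto
  then show ?thesis
    using keys_add[of b b']
    by (subst (1 2 3) bilin_superset[of ?A ?B])
       (auto simp: sum.distrib[symmetric] single_add[symmetric] lookup_add algebra_simps)
qed

lemma bilin_zero [simp]: "bilin s c 0 b = 0" "bilin s c a 0 = 0"
  by (simp_all add: bilin_def)

lemma bilin_single [simp]: "bilin s c (monom x e) (monom y e') = monom (s x y) (c x y * e * e')"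
  by (subst bilin_superset[of "{x}" "{y}"]) auto

lemma bilin_scal_left: "bilin s c (scal e a) b = scal e (bilin s c a b)"
  using keys_scal[of e a]
  by (subst (1 2) bilin_superset[of "Poly_Mapping.keys a" "Poly_Mapping.keys b"])
     (auto simp: scal_sum algebra_simps)

lemma bilin_scal_right: "bilin s c a (scal e b) = scal e (bilin s c a b)"
  using keys_scal[of e b]
  by (subst (1 2) bilin_superset[of "Poly_Mapping.keys a" "Poly_Mapping.keys b"])
     (auto simp: scal_sum algebra_simps)

lemma keys_bilin:
  assumes "k \<in> Poly_Mapping.keys (bilin s c a b)"
  shows "\<exists>x\<in>Poly_Mapping.keys a. \<exists>y\<in>Poly_Mapping.keys b. k = s x y \<and> c x y \<noteq> 0"
proof -
  have "\<exists>x\<in>Poly_Mapping.keys a. k \<in> Poly_Mapping.keys (\<Sum>y\<in>Poly_Mapping.keys b.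
     monom (s x y) (c x y * Poly_Mapping.lookup a x * Poly_Mapping.lookup b y))"
    using assms keys_sum unfolding bilin_def by fast
  then obtain x where x: "x \<in> Poly_Mapping.keys a" "k \<in> Poly_Mapping.keys (\<Sum>y\<in>Poly_Mapping.keys b.
     monom (s x y) (c x y * Poly_Mapping.lookup a x * Poly_Mapping.lookup b y))" by blast
  then obtain y where "y \<in> Poly_Mapping.keys b" "k \<in> Poly_Mapping.keys
     (monom (s x y) (c x y * Poly_Mapping.lookup a x * Poly_Mapping.lookup b y))"
    using keys_sum by fast
  then show ?thesis using x by (auto split: if_splits)
qed

lemma lookup_tens [simp]:
  "Poly_Mapping.lookup (tens a b) (m, g) = Poly_Mapping.lookup a m * Poly_Mapping.lookup b g"
proof -
  have "Poly_Mapping.lookup (tens a b) (m, g) = (\<Sum>m'\<in>Poly_Mapping.keys a. \<Sum>g'\<in>Poly_Mapping.keys b.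
      if m' = m then if g' = g then Poly_Mapping.lookup a m * Poly_Mapping.lookup b g else 0 else 0)"
    unfolding tens_def by (auto simp: lookup_sum lookup_single when_def intro!: sum.cong)
  also have "\<dots> = Poly_Mapping.lookup a m * Poly_Mapping.lookup b g"
  proof -
    have "(\<Sum>g'\<in>Poly_Mapping.keys b. if m' = m
        then if g' = g then Poly_Mapping.lookup a m * Poly_Mapping.lookup b g else 0 else 0)
      = (if m' = m then Poly_Mapping.lookup a m * Poly_Mapping.lookup b g else 0)" for m'
      by (cases "m' = m") (auto simp: in_keys_iff)
    then show ?thesis by (simp add: in_keys_iff)
  qed
  finally show ?thesis .
qed

lemma tens_single [simp]: "tens (monom m c) (monom g e) = monom (m, g) (c * e)"
  by (rule poly_mapping_eqI) (auto simp: lookup_single when_def split_paired_all)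

section \<open>Monomials\<close>

lemma wlen_madd [simp]: "wlen V (madd m m') = wlen V m + wlen V m'"
  by (simp add: wlen_def madd_def sum.distrib)

lemma mdeg_madd [simp]: "mdeg V (madd m m') = mdeg V m + mdeg V m'"
  by (simp add: mdeg_def madd_def sum.distrib algebra_simps)

lemma mone_simps [simp]: "mdeg V mone = 0" "wlen V mone = 0" "mone \<in> mons V"
    "madd mone m = m" "madd m mone = m"
  by (auto simp: mdeg_def wlen_def mone_def mons_def madd_def)

lemma madd_assoc: "madd (madd a b) c = madd a (madd b c)"
  by (simp add: madd_def algebra_simps)

lemma length_susp [simp]: "length (susp V) = length V"
  by (simp add: susp_def)

lemma nth_susp [simp]: "i < length V \<Longrightarrow> susp V ! i = V ! i - 1"
  by (simp add: susp_def)

lemma wlen_susp [simp]: "wlen (susp V) = wlen V"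
  by (simp add: wlen_def fun_eq_iff)

lemma mpow_sum: "i < length V \<Longrightarrow> (\<Sum>j<length V. mpow i p j * f j) = p * (f i :: nat)"
proof -
  assume i: "i < length V"
  have "(\<Sum>j<length V. mpow i p j * f j) = (\<Sum>j<length V. if j = i then p * f i else 0)"
    by (intro sum.cong) (auto simp: mpow_def)
  then show ?thesis using i by simp
qed

lemma mdeg_mpow [simp]: "i < length V \<Longrightarrow> mdeg V (mpow i p) = p * V ! i"
  unfolding mdeg_def by (rule mpow_sum)

lemma wlen_mpow [simp]: "i < length V \<Longrightarrow> wlen V (mpow i p) = p"
  unfolding wlen_def using mpow_sum[of i V p "\<lambda>_. 1"] by simp

lemma mpow_zero [simp]: "mpow i 0 = mone"
  by (auto simp: mpow_def mone_def)

lemma mons_mpow_one [simp]: "i < length V \<Longrightarrow> mpow i (Suc 0) \<in> mons V"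
  by (auto simp: mons_def mpow_def)

lemma mons_maddD: "madd a b \<in> mons V \<Longrightarrow> a \<in> mons V" "madd a b \<in> mons V \<Longrightarrow> b \<in> mons V"
  by (auto simp: mons_def madd_def dest!: spec)

lemma wlen_eq_0_iff: "m \<in> mons V \<Longrightarrow> wlen V m = 0 \<longleftrightarrow> m = mone"
  by (auto simp: wlen_def mons_def mone_def fun_eq_iff) (meson lessThan_iff not_less)

text \<open>The exponent of the Koszul sign, separated from the vanishing condition of
  \<open>lam_coeff\<close> because it is biadditive without restriction.\<close>

definition lexp :: "nat list \<Rightarrow> mono \<Rightarrow> mono \<Rightarrow> nat" where
  "lexp V m m' = (\<Sum>j<length V. \<Sum>i<j. (m j * V ! j) * (m' i * V ! i))"

lemma lexp_madd: "lexp V (madd a b) c = lexp V a c + lexp V b c"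
    "lexp V a (madd b c) = lexp V a b + lexp V a c"
  by (simp_all add: lexp_def madd_def sum.distrib algebra_simps)

lemma lam_coeff_lexp: "lam_coeff V m m' = (if madd m m' \<in> mons V then sg (int (lexp V m m')) else 0)"
  unfolding lam_coeff_def lexp_def power_sg ..

text \<open>Associativity of \<open>\<Lambda>V\<close> on structure constants. If the triple product
  survives, so do its partial products, and by biadditivity both signs have exponent
  \<open>lexp a b + lexp a c + lexp b c\<close>; otherwise both sides contain a zero factor.\<close>

lemma lam_coeff_cocycle:
  "lam_coeff V b c * lam_coeff V a (madd b c) = lam_coeff V a b * lam_coeff V (madd a b) c"
proof (cases "madd (madd a b) c \<in> mons V")
  case True
  then have "madd a (madd b c) \<in> mons V" by (simp add: madd_assoc)
  moreover have "madd a b \<in> mons V" "madd b c \<in> mons V"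
    using True calculation mons_maddD by blast+
  ultimately show ?thesis using True
    by (simp add: lam_coeff_lexp lexp_madd sg_add mult_ac)
next
  case False
  then show ?thesis by (simp add: lam_coeff_lexp madd_assoc)
qed

lemma lmult_single [simp]:
  "lmult V (monom a c) (monom b e) = monom (madd a b) (lam_coeff V a b * c * e)"
  by (simp add: lmult_def)

lemma lmult_assoc_single:
  "lmult V (monom a c) (lmult V (monom b e) y) = scal (lam_coeff V a b) (lmult V (monom (madd a b) (c * e)) y)"
proof -
  have "Poly_Mapping.keys y \<subseteq> UNIV" by simp
  then show ?thesis
  proof (induction y rule: keys_linear_induct)
    case zero
    then show ?case by (simp add: lmult_def)
  next
    case (single k t)
    have "lam_coeff V a (madd b k) * c * (lam_coeff V b k * e * t) =
          (lam_coeff V b k * lam_coeff V a (madd b k)) * (c * e * t)"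
      by (simp add: mult_ac)
    then show ?case by (simp add: madd_assoc lam_coeff_cocycle mult_ac)
  next
    case (add x y)
    then show ?case by (simp add: lmult_def bilin_add_right scal_add)
  qed
qed

lemma lexp_mone [simp]: "lexp V mone m = 0" "lexp V m mone = 0"
  by (simp_all add: lexp_def mone_def)

lemma lam_coeff_mone [simp]: "m \<in> mons V \<Longrightarrow> lam_coeff V mone m = 1" "m \<in> mons V \<Longrightarrow> lam_coeff V m mone = 1"
  by (simp_all add: lam_coeff_lexp)

lemma gam_coeff_mone [simp]:
  "g \<in> mons (susp V) \<Longrightarrow> gam_coeff V mone g = 1" "g \<in> mons (susp V) \<Longrightarrow> gam_coeff V g mone = 1"
  by (simp_all add: gam_coeff_def) (simp_all add: mone_def)

lemma pmult_single [simp]: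
  "pmult V (monom x c) (monom y e) =
   monom (madd (fst x) (fst y), madd (snd x) (snd y)) (lamgam_coeff V x y * c * e)"
  by (simp add: pmult_def)

lemma Lam_single [simp]: "m \<in> mons V \<Longrightarrow> monom m c \<in> Lam V"
  by (simp add: Lam_def)

lemma LamGam_single [simp]: "m \<in> mons V \<Longrightarrow> g \<in> mons (susp V) \<Longrightarrow> monom (m, g) c \<in> LamGam V"
  by (simp add: LamGam_def)

lemma Lam_zero [simp]: "0 \<in> Lam V" and LamGam_zero [simp]: "0 \<in> LamGam V"
  by (simp_all add: Lam_def LamGam_def)

lemma Lam_add [simp]: "a \<in> Lam V \<Longrightarrow> b \<in> Lam V \<Longrightarrow> a + b \<in> Lam V"
  using keys_add[of a b] by (auto simp: Lam_def)

lemma LamGam_add [simp]: "a \<in> LamGam V \<Longrightarrow> b \<in> LamGam V \<Longrightarrow> a + b \<in> LamGam V"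
  using keys_add[of a b] unfolding LamGam_def by auto

lemma Lam_scal [simp]: "a \<in> Lam V \<Longrightarrow> scal c a \<in> Lam V"
  using keys_scal[of c a] by (auto simp: Lam_def)

lemma LamGam_scal [simp]: "a \<in> LamGam V \<Longrightarrow> scal c a \<in> LamGam V"
  using keys_scal[of c a] unfolding LamGam_def by auto

lemma Lam_lmult [simp]: "lmult V a b \<in> Lam V"
  using keys_bilin[of _ madd "lam_coeff V" a b]
  by (fastforce simp: Lam_def lmult_def lam_coeff_def split: if_splits)

lemma LamGam_pmult [simp]: "pmult V a b \<in> LamGam V"
  using keys_bilin[of _ "\<lambda>x y. (madd (fst x) (fst y), madd (snd x) (snd y))" "lamgam_coeff V" a b]
  by (fastforce simp: LamGam_def pmult_def lamgam_coeff_def gam_coeff_def lam_coeff_def split: if_splits)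

lemma lmult_lone [simp]: "a \<in> Lam V \<Longrightarrow> lmult V lone a = a" "a \<in> Lam V \<Longrightarrow> lmult V a lone = a"
  unfolding Lam_def mem_Collect_eq
  by (induction a rule: keys_linear_induct) 
     (simp_all add: lone_def lmult_def bilin_add_right bilin_add_left)

lemma lmult_add: "lmult V (a + a') b = lmult V a b + lmult V a' b"
    "lmult V a (b + b') = lmult V a b + lmult V a b'"
    "lmult V (scal c a) b = scal c (lmult V a b)" "lmult V a (scal c b) = scal c (lmult V a b)"
    "lmult V 0 b = 0" "lmult V a 0 = 0"
  by (simp_all add: lmult_def bilin_add_right bilin_add_left bilin_scal_left bilin_scal_right)

lemma pmult_add: "pmult V (a + a') b = pmult V a b + pmult V a' b"
    "pmult V a (b + b') = pmult V a b + pmult V a b'"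
    "pmult V (scal c a) b = scal c (pmult V a b)" "pmult V a (scal c b) = scal c (pmult V a b)"
    "pmult V 0 b = 0" "pmult V a 0 = 0"
  by (simp_all add: pmult_def bilin_add_right bilin_add_left bilin_scal_left bilin_scal_right)

lemma tens_lin: "tens (a + a') b = tens a b + tens a' b"
    "tens a (b + b') = tens a b + tens a b'"
    "tens (scal c a) b = scal c (tens a b)" "tens a (scal c b) = scal c (tens a b)"
    "tens 0 b = 0" "tens a 0 = 0"
  by (rule poly_mapping_eqI, simp add: split_paired_all lookup_add algebra_simps)+

lemma pmult_tens_single [simp]:
  assumes "g \<in> mons (susp V)"
  shows "pmult V (tens (monom a c) lone) (monom (b, g) t) =
     scal (lam_coeff V a b) (monom (madd a b, g) (c * t))"
  using assms by (simp add: lone_def lamgam_coeff_def mult_ac)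

section \<open>Linear maps on carriers, the word length filtration and homogeneity\<close>

lemma linear_betweenD:
  assumes "linear_between A B f"
  shows "x \<in> A \<Longrightarrow> f x \<in> B" "x \<in> A \<Longrightarrow> y \<in> A \<Longrightarrow> f (x + y) = f x + f y"
    "x \<in> A \<Longrightarrow> f (scal c x) = scal c (f x)"
  using assms by (auto simp: linear_between_def)

lemma linear_between_zero:
  assumes "linear_between A B f" "0 \<in> A"
  shows "f 0 = 0"
  using linear_betweenD(3)[OF assms(1,2), of 0] by simp

lemma linear_between_single:
  assumes "linear_between A B f" "monom k 1 \<in> A"
  shows "f (monom k c) = scal c (f (monom k 1))"
  using linear_betweenD(3)[OF assms, of c] by simp

lemma lam_ge_simps:
  "0 \<in> Lam_ge V p" "a \<in> Lam_ge V p \<Longrightarrow> b \<in> Lam_ge V p \<Longrightarrow> a + b \<in> Lam_ge V p"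
  "a \<in> Lam_ge V p \<Longrightarrow> scal c a \<in> Lam_ge V p"
  using keys_add[of a b] keys_scal[of c a] by (auto simp: Lam_ge_def)

lemma lam_ge_Lam: "a \<in> Lam_ge V p \<Longrightarrow> a \<in> Lam V"
  by (simp add: Lam_ge_def)

lemma lam_ge_mono: "a \<in> Lam_ge V p \<Longrightarrow> q \<le> p \<Longrightarrow> a \<in> Lam_ge V q"
  by (fastforce simp: Lam_ge_def)

lemma lam_ge_lookup: "a \<in> Lam_ge V p \<Longrightarrow> int (wlen V m) < p \<Longrightarrow> Poly_Mapping.lookup a m = 0"
  by (metis (mono_tags, lifting) Lam_ge_def in_keys_iff mem_Collect_eq not_le)

lemma lam_ge_lmult:
  assumes "a \<in> Lam_ge V p" "b \<in> Lam_ge V q"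
  shows "lmult V a b \<in> Lam_ge V (p + q)"
proof -
  have "p + q \<le> int (wlen V k)" if "k \<in> Poly_Mapping.keys (lmult V a b)" for k
    using keys_bilin[OF that[unfolded lmult_def]] assms by (fastforce simp: Lam_ge_def)
  then show ?thesis unfolding Lam_ge_def by simp
qed

lemma lhomog_simps:
  "lhomog V j 0" "lhomog V j a \<Longrightarrow> lhomog V j b \<Longrightarrow> lhomog V j (a + b)"
  "lhomog V j a \<Longrightarrow> lhomog V j (scal c a)"
  using keys_add[of a b] keys_scal[of c a] by (auto simp: lhomog_def)

lemma lhomog_lmult:
  assumes "lhomog V i a" "lhomog V j b"
  shows "lhomog V (i + j) (lmult V a b)"
  using assms keys_bilin[of _ madd "lam_coeff V" a b]
  by (fastforce simp: lhomog_def lmult_def)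

section \<open>The signed Koszul complex on coefficients\<close>

definition bump :: "nat \<Rightarrow> mono \<Rightarrow> mono" where
  "bump i m = m(i := Suc (m i))"

definition drop1 :: "nat \<Rightarrow> mono \<Rightarrow> mono" where
  "drop1 i m = m(i := m i - 1)"

definition cells :: "nat list \<Rightarrow> (mono \<times> mono) set" where
  "cells V = mons V \<times> mons (susp V)"

text \<open>
  A map \<open>f\<close> of degree \<open>q\<close> is recorded by \<open>u m g\<close>, the coefficient of the monomial \<open>m\<close> in
  \<open>f(1 \<otimes> g)\<close>; \<open>koszul V q u\<close> records \<open>(-1)^(q+1) f \<circ> D\<close> for the derivation \<open>D\<close> with
  \<open>D(sv) = v\<close>. The term \<open>q |v\<^sub>i|\<close> of the sign comes from graded linearity of \<open>f\<close>, the first sum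
  from moving \<open>D\<close> and then \<open>v\<^sub>i\<close> past the divided powers preceding \<open>sv\<^sub>i\<close>, the second one from
  moving \<open>v\<^sub>i\<close> to its place in \<open>m\<close>.
\<close>

definition ksign :: "nat list \<Rightarrow> int \<Rightarrow> nat \<Rightarrow> mono \<Rightarrow> mono \<Rightarrow> rat" where
  "ksign V q i m g = sg (q + 1 + q * int (V ! i)
     + (int (V ! i) + 1) * (\<Sum>j<i. int (g j) * (int (V ! j) - 1))
     + int (V ! i) * (\<Sum>j<i. int (m j) * int (V ! j)))"

definition koszul :: "nat list \<Rightarrow> int \<Rightarrow> (mono \<Rightarrow> mono \<Rightarrow> rat) \<Rightarrow> mono \<Rightarrow> mono \<Rightarrow> rat" where
  "koszul V q u m g = (\<Sum>i | i < length V \<and> 0 < m i \<and> 0 < g i.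
     ksign V q i m g * u (drop1 i m) (drop1 i g))"

lemma bump_drop1: "0 < m i \<Longrightarrow> bump i (drop1 i m) = m" and drop1_bump [simp]: "drop1 i (bump i m) = m"
  by (auto simp: bump_def drop1_def)

lemma bump_drop1_commute: "i \<noteq> j \<Longrightarrow> bump i (drop1 j m) = drop1 j (bump i m)"
  by (auto simp: bump_def drop1_def)

lemma mons_drop1 [simp]: "m \<in> mons V \<Longrightarrow> drop1 i m \<in> mons V"
  by (auto simp: mons_def drop1_def)

lemma cells_drop1: "(m, g) \<in> cells V \<Longrightarrow> (drop1 i m, drop1 i g) \<in> cells V"
  by (simp add: cells_def)

lemma ksign_sq [simp]: "ksign V q i m g * ksign V q i m g = 1"
  by (simp add: ksign_def)

lemma sum_upd_int:
  fixes f :: "nat \<Rightarrow> int"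
  shows "(\<Sum>j<i. int ((m(k := a)) j) * f j) =
    (\<Sum>j<i. int (m j) * f j) + (if k < i then (int a - int (m k)) * f k else 0)"
proof -
  have "(\<Sum>j<i. int ((m(k := a)) j) * f j) =
      (\<Sum>j<i. int (m j) * f j + (if j = k then (int a - int (m k)) * f k else 0))"
    by (intro sum.cong) (auto simp: algebra_simps)
  then show ?thesis by (simp add: sum.distrib)
qed

text \<open>Let \<open>a\<close>, \<open>b\<close> be the degrees of the two generators. The sign at
  the larger index sees the move at the smaller one, which contributes
  \<open>(a+1)(b+1) + ab\<close>; passing from \<open>q\<close> to \<open>q - 1\<close> in both
  signs contributes \<open>a + b\<close>. The total is odd.\<close>

lemma ksign_anticommute:
  assumes "i \<noteq> j" "0 < m j" "0 < g j"
  shows "ksign V (q - 1) j m g * ksign V (q - 1) i (bump i (drop1 j m)) (bump i (drop1 j g)) =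
       - (ksign V q i (bump i m) (bump i g) * ksign V q j (bump i m) (bump i g))"
proof -
  have [simp]: "int (m j - Suc 0) = int (m j) - 1" "int (g j - Suc 0) = int (g j) - 1"
    using assms by auto
  show ?thesis
    using assms(1)
    unfolding ksign_def bump_def drop1_def sum_upd_int sg_add[symmetric]
    by (cases "i < j") (auto simp: sg_def)
qed

text \<open>
  The Koszul complex is a tensor product over the generators; \<open>homotopy V q i\<close> contracts the
  \<open>i\<close>-th factor onto its one-dimensional homology, spanned by \<open>v\<^sub>i\<close> for odd and by the dual of
  \<open>sv\<^sub>i\<close> for even \<open>|v\<^sub>i|\<close>. Failure of \<open>contractible_at V i m g\<close> says that \<open>(m, g)\<close> has this
  homology class as its \<open>i\<close>-th factor.
\<close>

definition homotopy :: "nat list \<Rightarrow> int \<Rightarrow> nat \<Rightarrow> (mono \<Rightarrow> mono \<Rightarrow> rat) \<Rightarrow> mono \<Rightarrow> mono \<Rightarrow> rat" where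
  "homotopy V q i u m g = (if (bump i m, bump i g) \<in> cells V
     then ksign V (q - 1) i (bump i m) (bump i g) * u (bump i m) (bump i g) else 0)"

definition contractible_at :: "nat list \<Rightarrow> nat \<Rightarrow> mono \<Rightarrow> mono \<Rightarrow> bool" where
  "contractible_at V i m g \<longleftrightarrow> (bump i m, bump i g) \<in> cells V \<or> (0 < m i \<and> 0 < g i)"

text \<open>One coordinate is bounded by 1: \<open>m i\<close> for odd and \<open>g i\<close> for
  even \<open>|v\<^sub>i|\<close>. Room to increase it means that it is 0. Positive degrees ensure
  that the truncated subtraction in \<open>susp\<close> flips parity.\<close>

lemma cells_bump_excl:
  assumes "(bump i m, bump i g) \<in> cells V" "i < length V" "\<forall>k\<in>set V. 1 \<le> k"
  shows "\<not> (0 < m i \<and> 0 < g i)"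
proof -
  have "1 \<le> V ! i" using assms by simp
  then show ?thesis using assms(1,2)
    by (cases "odd (V ! i)") (auto simp: cells_def mons_def bump_def)
qed

lemma cells_bump_drop1:
  assumes "(m, g) \<in> cells V" "i \<noteq> j"
  shows "(bump i (drop1 j m), bump i (drop1 j g)) \<in> cells V \<longleftrightarrow> (bump i m, bump i g) \<in> cells V"
proof
  assume "(bump i m, bump i g) \<in> cells V"
  then show "(bump i (drop1 j m), bump i (drop1 j g)) \<in> cells V"
    using assms(2) cells_drop1 by (simp add: bump_drop1_commute)
next
  assume "(bump i (drop1 j m), bump i (drop1 j g)) \<in> cells V"
  then show "(bump i m, bump i g) \<in> cells V"
    using assms by (auto simp: cells_def mons_def bump_def drop1_def split: if_splits)
qed

lemma contractible_at_drop1: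
  assumes "(m, g) \<in> cells V" "i \<noteq> j"
  shows "contractible_at V i (drop1 j m) (drop1 j g) \<longleftrightarrow> contractible_at V i m g"
  using cells_bump_drop1[OF assms] assms(2) by (simp add: contractible_at_def drop1_def)

text \<open>If the cell can be bumped at \<open>i\<close>, the cycle condition is evaluated at the
  bumped cell: its summand \<open>j = i\<close> is \<open>u m g\<close> up to sign, and by
  anticommutation the remaining summands are those of the left side up to a common sign. If it
  cannot, only the summand \<open>j = i\<close> survives, where bump and drop cancel.\<close>

lemma koszul_homotopy:
  assumes cyc: "\<And>m g. (m, g) \<in> cells V \<Longrightarrow> koszul V q u m g = 0"
    and c: "(m, g) \<in> cells V" and i: "i < length V" and V: "\<forall>k\<in>set V. 1 \<le> k"
  shows "koszul V (q - 1) (homotopy V q i u) m g = (if contractible_at V i m g then u m g else 0)"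
proof -
  define J where "J = {j. j < length V \<and> 0 < m j \<and> 0 < g j}"
  have fin: "finite J" by (simp add: J_def)
  have term_i: "ksign V (q - 1) i m g * homotopy V q i u (drop1 i m) (drop1 i g) = u m g" if "i \<in> J"
    using that c by (simp add: J_def homotopy_def bump_drop1 mult.assoc[symmetric])
  show ?thesis
  proof (cases "(bump i m, bump i g) \<in> cells V")
    case True
    let ?s = "ksign V q i (bump i m) (bump i g)"
    have nJ: "i \<notin> J" using cells_bump_excl[OF True i V] by (simp add: J_def)
    have "{j. j < length V \<and> 0 < bump i m j \<and> 0 < bump i g j} = insert i J"
      using i nJ by (auto simp: J_def bump_def)
    then have "0 = (\<Sum>j\<in>insert i J. ksign V q j (bump i m) (bump i g)
         * u (drop1 j (bump i m)) (drop1 j (bump i g)))"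
      using cyc[OF True] by (simp add: koszul_def)
    also have "\<dots> = ?s * u m g + (\<Sum>j\<in>J. ksign V q j (bump i m) (bump i g)
         * u (drop1 j (bump i m)) (drop1 j (bump i g)))"
      using nJ fin by simp
    finally have *: "(\<Sum>j\<in>J. ksign V q j (bump i m) (bump i g)
         * u (drop1 j (bump i m)) (drop1 j (bump i g))) = - (?s * u m g)" by simp
    have "koszul V (q - 1) (homotopy V q i u) m g =
        (\<Sum>j\<in>J. - ?s * (ksign V q j (bump i m) (bump i g) * u (drop1 j (bump i m)) (drop1 j (bump i g))))"
      unfolding koszul_def J_def[symmetric]
    proof (intro sum.cong refl)
      fix j assume j: "j \<in> J"
      then have ij: "i \<noteq> j" "0 < m j" "0 < g j" using nJ by (auto simp: J_def)
      have "homotopy V q i u (drop1 j m) (drop1 j g) = ksign V (q - 1) i (bump i (drop1 j m)) (bump i (drop1 j g))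
          * u (drop1 j (bump i m)) (drop1 j (bump i g))"
        using True cells_bump_drop1[OF c ij(1)] ij(1) by (simp add: homotopy_def bump_drop1_commute)
      then have "ksign V (q - 1) j m g * homotopy V q i u (drop1 j m) (drop1 j g) =
          (ksign V (q - 1) j m g * ksign V (q - 1) i (bump i (drop1 j m)) (bump i (drop1 j g)))
          * u (drop1 j (bump i m)) (drop1 j (bump i g))"
        by (simp only: mult.assoc)
      also have "\<dots> = - ?s * (ksign V q j (bump i m) (bump i g) * u (drop1 j (bump i m)) (drop1 j (bump i g)))"
        by (subst ksign_anticommute[of i j m g V q, OF ij]) (simp add: mult.assoc)
      finally show "ksign V (q - 1) j m g * homotopy V q i u (drop1 j m) (drop1 j g) =
          - ?s * (ksign V q j (bump i m) (bump i g) * u (drop1 j (bump i m)) (drop1 j (bump i g)))" .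
    qed
    also have "\<dots> = (?s * ?s) * u m g"
      unfolding sum_distrib_left[symmetric] * by (simp add: mult_ac)
    finally show ?thesis using True by (simp add: contractible_at_def)
  next
    case False
    have "koszul V (q - 1) (homotopy V q i u) m g = (\<Sum>j\<in>J. if j = i then u m g else 0)"
      unfolding koszul_def J_def[symmetric]
    proof (intro sum.cong refl)
      fix j assume j: "j \<in> J"
      show "ksign V (q - 1) j m g * homotopy V q i u (drop1 j m) (drop1 j g) = (if j = i then u m g else 0)"
        using j term_i False cells_bump_drop1[OF c, of i j] by (cases "j = i") (auto simp: homotopy_def)
    qed
    also have "\<dots> = (if i \<in> J then u m g else 0)" using fin by simp
    finally show ?thesis using False i by (simp add: contractible_at_def J_def)
  qed
qed

text \<open>Moves at other generators do not change contractibility at \<open>i\<close>, and a move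
  at \<open>i\<close> leads from a contractible cell to a contractible one. The differential
  therefore respects the splitting into the two kinds of cells.\<close>

lemma koszul_restrict_cycle:
  assumes cyc: "\<And>m g. (m, g) \<in> cells V \<Longrightarrow> koszul V q u m g = 0"
    and c: "(m, g) \<in> cells V" and i: "i < length V"
  shows "koszul V q (\<lambda>m g. if contractible_at V i m g then 0 else u m g) m g = 0"
proof (cases "contractible_at V i m g")
  case True
  show ?thesis
    unfolding koszul_def
  proof (intro sum.neutral ballI)
    fix j assume "j \<in> {i. i < length V \<and> 0 < m i \<and> 0 < g i}"
    then have j: "0 < m j" "0 < g j" by auto
    have "contractible_at V i (drop1 j m) (drop1 j g)"
    proof (cases "i = j")
      case True
      then show ?thesis using j c by (simp add: contractible_at_def bump_drop1)
    next
      case False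
      then show ?thesis using True contractible_at_drop1[OF c False] by simp
    qed
    then show "ksign V q j m g * (if contractible_at V i (drop1 j m) (drop1 j g) then 0
        else u (drop1 j m) (drop1 j g)) = 0" by simp
  qed
next
  case False
  have "koszul V q (\<lambda>m g. if contractible_at V i m g then 0 else u m g) m g = koszul V q u m g"
    unfolding koszul_def
  proof (intro sum.cong refl)
    fix j assume "j \<in> {i. i < length V \<and> 0 < m i \<and> 0 < g i}"
    then have "i \<noteq> j" using False by (auto simp: contractible_at_def)
    then have "\<not> contractible_at V i (drop1 j m) (drop1 j g)"
      using False contractible_at_drop1[OF c] by simp
    then show "ksign V q j m g * (if contractible_at V i (drop1 j m) (drop1 j g) then 0
        else u (drop1 j m) (drop1 j g)) = ksign V q j m g * u (drop1 j m) (drop1 j g)" by simp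
  qed
  then show ?thesis using cyc[OF c] by simp
qed

lemma koszul_add: "koszul V q (\<lambda>m g. u m g + v m g) m g = koszul V q u m g + koszul V q v m g"
  by (simp add: koszul_def sum.distrib algebra_simps)

section \<open>Exactness of the Koszul complex away from one cell\<close>

definition omega_lam :: "nat list \<Rightarrow> mono" where
  "omega_lam V i = (if i < length V \<and> odd (V ! i) then 1 else 0)"

definition omega_gam :: "nat list \<Rightarrow> mono" where
  "omega_gam V i = (if i < length V \<and> even (V ! i) then 1 else 0)"

text \<open>At each generator the coordinate bounded by 1 cannot be 0, as it could then be bumped;
  so it is 1, and the other coordinate is forced to be 0.\<close>

lemma not_contractible:
  assumes c: "(m, g) \<in> cells V" and V: "\<forall>k\<in>set V. 1 \<le> k"
    and n: "\<And>i. i < length V \<Longrightarrow> \<not> contractible_at V i m g"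
  shows "m = omega_lam V \<and> g = omega_gam V"
proof -
  have "m i = omega_lam V i \<and> g i = omega_gam V i" for i
  proof (cases "i < length V")
    case True
    then have "1 \<le> V ! i" using V by simp
    have "\<not> (bump i m, bump i g) \<in> cells V" "\<not> (0 < m i \<and> 0 < g i)"
      using n[OF True] by (auto simp: contractible_at_def)
    moreover have "(bump i m, bump i g) \<in> cells V" if "odd (V ! i)" "m i = 0"
      using c that True \<open>1 \<le> V ! i\<close> by (auto simp: cells_def mons_def bump_def)
    moreover have "(bump i m, bump i g) \<in> cells V" if "even (V ! i)" "g i = 0"
      using c that True \<open>1 \<le> V ! i\<close> by (auto simp: cells_def mons_def bump_def)
    moreover have "odd (V ! i) \<Longrightarrow> m i \<le> 1" "even (V ! i) \<Longrightarrow> g i \<le> 1"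
      using c True \<open>1 \<le> V ! i\<close> by (auto simp: cells_def mons_def)
    ultimately show ?thesis using True
      by (cases "odd (V ! i)") (auto simp: omega_lam_def omega_gam_def le_Suc_eq)
  next
    case False
    then show ?thesis using c by (auto simp: cells_def mons_def omega_lam_def omega_gam_def)
  qed
  then show ?thesis by auto
qed

text \<open>The tensor factors are contracted one after the other, and what is left at the end could
  live only on the omega cell. The support condition on \<open>v\<close> determines its word lengths
  and degree when it is later turned into a module map.\<close>

lemma koszul_exact:
  assumes cyc: "\<And>m g. (m, g) \<in> cells V \<Longrightarrow> koszul V q u m g = 0"
    and V: "\<forall>k\<in>set V. 1 \<le> k" and omega: "u (omega_lam V) (omega_gam V) = 0"
  obtains v where "\<And>m g. (m, g) \<in> cells V \<Longrightarrow> koszul V (q - 1) v m g = u m g"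
    and "\<And>m g. v m g \<noteq> 0 \<Longrightarrow>
      \<exists>i<length V. (bump i m, bump i g) \<in> cells V \<and> u (bump i m) (bump i g) \<noteq> 0"
proof -
  \<comment> \<open>What remains of \<open>u\<close> after the first \<open>l\<close> factors have
    been contracted.\<close>
  define w where "w l m g = (if \<exists>i<l. contractible_at V i m g then 0 else u m g)" for l m g
  have "(\<forall>m g. (m, g) \<in> cells V \<longrightarrow> koszul V q (w l) m g = 0) \<and>
     (\<exists>v. (\<forall>m g. (m, g) \<in> cells V \<longrightarrow> koszul V (q - 1) v m g = u m g - w l m g) \<and>
       (\<forall>m g. v m g \<noteq> 0 \<longrightarrow>
         (\<exists>i<length V. (bump i m, bump i g) \<in> cells V \<and> u (bump i m) (bump i g) \<noteq> 0)))"
    if "l \<le> length V" for l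
    using that
  proof (induction l)
    case 0
    have "w 0 = u" by (simp add: w_def fun_eq_iff)
    then show ?case using cyc by (auto intro!: exI[of _ "\<lambda>_ _. 0"] simp: koszul_def)
  next
    case (Suc l)
    then have l: "l < length V" by simp
    from Suc obtain v where wcyc: "\<And>m g. (m, g) \<in> cells V \<Longrightarrow> koszul V q (w l) m g = 0"
      and v: "\<And>m g. (m, g) \<in> cells V \<Longrightarrow> koszul V (q - 1) v m g = u m g - w l m g"
      "\<And>m g. v m g \<noteq> 0 \<Longrightarrow>
         \<exists>i<length V. (bump i m, bump i g) \<in> cells V \<and> u (bump i m) (bump i g) \<noteq> 0"
      by auto
    have w: "w (Suc l) = (\<lambda>m g. if contractible_at V l m g then 0 else w l m g)"
      by (auto simp: w_def fun_eq_iff less_Suc_eq)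
    let ?v = "\<lambda>m g. v m g + homotopy V q l (w l) m g"
    have "koszul V (q - 1) ?v m g = u m g - w (Suc l) m g" if "(m, g) \<in> cells V" for m g
    proof -
      have "koszul V (q - 1) (homotopy V q l (w l)) m g = (if contractible_at V l m g then w l m g else 0)"
        by (rule koszul_homotopy[OF _ that l V]) (rule wcyc)
      then show ?thesis unfolding koszul_add v(1)[OF that] by (simp add: w)
    qed
    moreover have "\<exists>i<length V. (bump i m, bump i g) \<in> cells V \<and> u (bump i m) (bump i g) \<noteq> 0"
      if "?v m g \<noteq> 0" for m g
    proof (cases "v m g = 0")
      case True
      then have "homotopy V q l (w l) m g \<noteq> 0" using that by simp
      then show ?thesis using l by (auto simp: homotopy_def w_def split: if_splits)
    qed (use v(2) in auto)
    moreover have "koszul V q (w (Suc l)) m g = 0" if "(m, g) \<in> cells V" for m g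
      unfolding w by (rule koszul_restrict_cycle[OF wcyc that l])
    ultimately show ?case by blast
  qed
  from this[of "length V"] obtain v
    where v: "\<And>m g. (m, g) \<in> cells V \<Longrightarrow> koszul V (q - 1) v m g = u m g - w (length V) m g"
    "\<And>m g. v m g \<noteq> 0 \<Longrightarrow>
      \<exists>i<length V. (bump i m, bump i g) \<in> cells V \<and> u (bump i m) (bump i g) \<noteq> 0"
    by auto
  have "w (length V) m g = 0" if "(m, g) \<in> cells V" for m g
    using not_contractible[OF that V] omega by (auto simp: w_def)
  then show ?thesis using that v by auto
qed

section \<open>Leading part of the differential of the acyclic closure\<close>

text \<open>Home of the error terms of \<open>D\<close>. The first bound says that each term has a
  factor from \<open>V\<close>; the second one measures total word length, in which the errors
  exceed the Koszul part.\<close>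

definition remainder :: "nat list \<Rightarrow> nat \<Rightarrow> lamgam set" where
  "remainder V n = {x \<in> LamGam V. \<forall>(m, g)\<in>Poly_Mapping.keys x. 1 \<le> wlen V m \<and> n \<le> wlen V m + wlen V g}"

lemma remainder_zero [simp]: "0 \<in> remainder V n"
  by (simp add: remainder_def)

lemma remainder_add: "x \<in> remainder V n \<Longrightarrow> y \<in> remainder V n \<Longrightarrow> x + y \<in> remainder V n"
  using keys_add[of x y] by (fastforce simp: remainder_def)

lemma remainder_scal: "x \<in> remainder V n \<Longrightarrow> scal c x \<in> remainder V n"
  using keys_scal[of c x] by (fastforce simp: remainder_def)

lemma remainder_pmult_right:
  assumes "x \<in> remainder V n"
  shows "pmult V x (monom (a, h) c) \<in> remainder V (n + wlen V a + wlen V h)"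
  unfolding remainder_def
proof (intro CollectI conjI ballI)
  fix k assume "k \<in> Poly_Mapping.keys (pmult V x (monom (a, h) c))"
  then obtain y where "y \<in> Poly_Mapping.keys x" "k = (madd (fst y) a, madd (snd y) h)"
    unfolding pmult_def using keys_bilin by (fastforce split: if_splits)
  then show "case k of (m, g) \<Rightarrow> 1 \<le> wlen V m \<and> n + wlen V a + wlen V h \<le> wlen V m + wlen V g"
    using assms by (fastforce simp: remainder_def)
qed simp

lemma remainder_pmult_left:
  assumes "x \<in> remainder V n"
  shows "pmult V (monom (a, h) c) x \<in> remainder V (n + wlen V a + wlen V h)"
  unfolding remainder_def
proof (intro CollectI conjI ballI)
  fix k assume "k \<in> Poly_Mapping.keys (pmult V (monom (a, h) c) x)"
  then obtain y where "y \<in> Poly_Mapping.keys x" "k = (madd a (fst y), madd h (snd y))"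
    unfolding pmult_def using keys_bilin by (fastforce split: if_splits)
  then show "case k of (m, g) \<Rightarrow> 1 \<le> wlen V m \<and> n + wlen V a + wlen V h \<le> wlen V m + wlen V g"
    using assms by (fastforce simp: remainder_def)
qed simp

text \<open>\<open>D\<close> of degree 1 and then \<open>v\<^sub>i\<close> pass the divided powers
  preceding \<open>sv\<^sub>i\<close>.\<close>

definition dsign :: "nat list \<Rightarrow> nat \<Rightarrow> mono \<Rightarrow> rat" where
  "dsign V i g = sg ((int (V ! i) + 1) * (\<Sum>j<i. int (g j) * (int (V ! j) - 1)))"

text \<open>\<open>leading V g\<close> is the value of the Koszul differential at \<open>1 \<otimes> g\<close>.\<close>

definition leading :: "nat list \<Rightarrow> mono \<Rightarrow> lamgam" where
  "leading V g = (\<Sum>i | i < length V \<and> 0 < g i. monom (mpow i 1, drop1 i g) (dsign V i g))"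

text \<open>All indices in \<open>h\<close> lie below \<open>l\<close>, so the factors are already
  in order and no two powers of the same generator are merged.\<close>

lemma gam_coeff_split:
  assumes "\<forall>j\<ge>l. h j = 0" "madd h (mpow l p) \<in> mons (susp V)"
  shows "gam_coeff V h (mpow l p) = 1"
proof -
  have "lexp (susp V) h (mpow l p) = 0"
    using assms(1) by (auto simp: lexp_def mpow_def intro!: sum.neutral)
  moreover have "((h i + mpow l p i) choose h i) = 1" for i
    using assms(1) by (auto simp: mpow_def)
  ultimately show ?thesis using assms(2) by (simp add: gam_coeff_def lam_coeff_lexp)
qed

lemma pmult_sum_left: "pmult V (sum f S) y = (\<Sum>s\<in>S. pmult V (f s) y)"
  by (induction S rule: infinite_finite_induct) (auto simp: pmult_add)

lemma mdeg_susp_upto: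
  assumes "\<forall>j\<ge>l. g j = 0" "l \<le> length V" "\<forall>k\<in>set V. 1 \<le> k"
  shows "int (mdeg (susp V) g) = (\<Sum>j<l. int (g j) * (int (V ! j) - 1))"
proof -
  have "mdeg (susp V) g = (\<Sum>j<length V. g j * (V ! j - 1))"
    by (simp add: mdeg_def)
  also have "\<dots> = (\<Sum>j<l. g j * (V ! j - 1))"
    using assms(1,2) by (intro sum.mono_neutral_right) auto
  also have "int \<dots> = (\<Sum>j<l. int (g j) * (int (V ! j) - 1))"
    using assms(2,3) by (auto intro!: sum.cong simp: of_nat_diff)
  finally show ?thesis .
qed

lemma pmult_diff: "pmult V (a - a') b = pmult V a b - pmult V a' b"
    "pmult V a (b - b') = pmult V a b - pmult V a b'"
  using pmult_add(1)[of V "a - a'" a' b] pmult_add(2)[of V a "b - b'" b'] by (simp_all add: algebra_simps)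

text \<open>Shared setting for a differential and its first term, each with its own acyclic closure;
  it is entered once for each of them.\<close>

locale minimal_closure =
  fixes V :: "nat list" and d :: "lam \<Rightarrow> lam" and D :: "lamgam \<Rightarrow> lamgam"
  assumes V2: "\<forall>j\<in>set V. 2 \<le> j"
    and der: "derivation V d"
    and dgen: "\<And>i. i < length V \<Longrightarrow> d (gen i) \<in> Lam_ge V 2"
    and acl: "acyclic_closure V d D"
begin

lemma V1: "\<forall>k\<in>set V. 1 \<le> k"
  using V2 by auto

lemma d_linear: "linear_between (Lam V) (Lam V) d"
  using der by (simp add: derivation_def)

lemma D_linear: "linear_between (LamGam V) (LamGam V) D"
  using acl by (simp add: acyclic_closure_def)

lemmas d_lin = linear_betweenD[OF d_linear]
lemmas D_lin = linear_betweenD[OF D_linear]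

lemma d_zero [simp]: "d 0 = 0" and D_zero [simp]: "D 0 = 0"
  using linear_between_zero[OF d_linear] linear_between_zero[OF D_linear] by auto

lemma d_leibniz: "a \<in> Lam V \<Longrightarrow> b \<in> Lam V \<Longrightarrow> lhomog V j a \<Longrightarrow>
    d (lmult V a b) = lmult V (d a) b + scal (sg j) (lmult V a (d b))"
  using der by (simp add: derivation_def powi_sg)

lemma d_homog: "a \<in> Lam V \<Longrightarrow> lhomog V j a \<Longrightarrow> lhomog V (j + 1) (d a)"
  using der by (simp add: derivation_def)

lemma D_leibniz: "x \<in> LamGam V \<Longrightarrow> y \<in> LamGam V \<Longrightarrow> phomog V j x \<Longrightarrow>
    D (pmult V x y) = pmult V (D x) y + scal (sg j) (pmult V x (D y))"
  using acl by (simp add: acyclic_closure_def powi_sg)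

lemma D_homog: "x \<in> LamGam V \<Longrightarrow> phomog V j x \<Longrightarrow> phomog V (j + 1) (D x)"
  using acl by (simp add: acyclic_closure_def)

lemma D_D: "x \<in> LamGam V \<Longrightarrow> D (D x) = 0"
  using acl by (simp add: acyclic_closure_def)

lemma D_tens_lone: "a \<in> Lam V \<Longrightarrow> D (tens a lone) = tens (d a) lone"
  using acl by (simp add: acyclic_closure_def)

lemma tens_lone_LamGam: "a \<in> Lam V \<Longrightarrow> tens a lone \<in> LamGam V"
  by (fastforce simp: Lam_def LamGam_def in_keys_iff lone_def lookup_single when_def split: if_splits)

text \<open>\<open>word_term\<close> does not state that a derived differential squares to zero.
  This is read off from \<open>D (D x) = 0\<close>, since \<open>a \<mapsto> a \<otimes> 1\<close>
  is injective and commutes with the differentials.\<close>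

lemma d_d: 
  assumes "a \<in> Lam V"
  shows "d (d a) = 0"
proof (rule poly_mapping_eqI)
  fix k
  have "tens (d (d a)) lone = 0"
    using D_D[OF tens_lone_LamGam[OF assms]] assms by (simp add: D_tens_lone d_lin)
  then have "Poly_Mapping.lookup (tens (d (d a)) lone) (k, mone) = 0" by simp
  then show "Poly_Mapping.lookup (d (d a)) k = Poly_Mapping.lookup 0 k" by (simp add: lone_def)
qed

lemma d_lone: "d lone = 0"
proof -
  have l: "lone \<in> Lam V" "lhomog V 0 lone" by (auto simp: lone_def lhomog_def)
  have "d (lmult V lone lone) = lmult V (d lone) lone + lmult V lone (d lone)"
    using d_leibniz[OF l(1) l(1) l(2)] by simp
  then show ?thesis using l d_lin(1) by simp
qed

lemma d_single_ge: "m \<in> mons V \<Longrightarrow> d (monom m 1) \<in> Lam_ge V (int (wlen V m) + 1)"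
proof (induction "wlen V m" arbitrary: m)
  case 0
  then have "monom m 1 = lone" by (simp add: lone_def wlen_eq_0_iff)
  then show ?case by (simp add: d_lone lam_ge_simps)
next
  case (Suc n)
  then have "m \<noteq> mone" by auto
  then obtain i where i: "0 < m i" by (auto simp: mone_def)
  then have l: "i < length V" using Suc.prems unfolding mons_def by (metis (mono_tags, lifting) mem_Collect_eq not_less less_irrefl)
  let ?r = "drop1 i m" and ?c = "lam_coeff V (mpow i 1) (drop1 i m)"
  have m: "m = madd (mpow i 1) ?r" using i by (auto simp: madd_def mpow_def drop1_def)
  have wl: "wlen V m = Suc (wlen V ?r)" using l by (subst m) simp
  have r: "?r \<in> mons V" using Suc.prems by simp
  have IH: "d (monom ?r 1) \<in> Lam_ge V (int (wlen V ?r) + 1)"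
    using Suc r wl by auto
  \<comment> \<open>The Koszul sign for pulling one \<open>v\<^sub>i\<close> to the front is its own
    inverse, so the monomial is a signed product with \<open>gen i\<close>.\<close>
  have "?c * ?c = 1" using m Suc.prems by (simp add: lam_coeff_lexp)
  then have "monom m 1 = scal ?c (lmult V (gen i) (monom ?r 1))"
    using m by (simp add: gen_def)
  moreover have g: "gen i \<in> Lam V" "lhomog V (int (V ! i)) (gen i)" "gen i \<in> Lam_ge V 1"
    using l by (auto simp: gen_def lhomog_def Lam_ge_def Lam_def)
  ultimately have "d (monom m 1) = scal ?c (lmult V (d (gen i)) (monom ?r 1)
      + scal (sg (int (V ! i))) (lmult V (gen i) (d (monom ?r 1))))"
    using d_leibniz[OF g(1) _ g(2)] r by (simp add: d_lin)
  moreover have "lmult V (d (gen i)) (monom ?r 1) \<in> Lam_ge V (2 + int (wlen V ?r))"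
    using dgen[OF l] r by (intro lam_ge_lmult) (auto simp: Lam_ge_def Lam_def)
  moreover have "lmult V (gen i) (d (monom ?r 1)) \<in> Lam_ge V (1 + (int (wlen V ?r) + 1))"
    by (intro lam_ge_lmult g IH)
  ultimately show ?case by (simp add: lam_ge_simps wl add_ac)
qed

lemma d_ge: 
  assumes "a \<in> Lam_ge V p"
  shows "d a \<in> Lam_ge V (p + 1)"
proof -
  have "Poly_Mapping.keys a \<subseteq> {m \<in> mons V. p \<le> int (wlen V m)}"
    using assms by (auto simp: Lam_ge_def Lam_def)
  then show ?thesis
  proof (induction a rule: keys_linear_induct)
    case zero
    then show ?case by (simp add: lam_ge_simps)
  next
    case (single k c)
    then have "d (monom k c) = scal c (d (monom k 1))"
      by (intro linear_between_single[OF d_linear]) simp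
    moreover have "d (monom k 1) \<in> Lam_ge V (p + 1)"
      using single by (intro lam_ge_mono[OF d_single_ge]) auto
    ultimately show ?case by (simp add: lam_ge_simps)
  next
    case (add x y)
    then have "x \<in> Lam V" "y \<in> Lam V" by (auto simp: Lam_def)
    then show ?case using add by (simp add: d_lin lam_ge_simps)
  qed
qed

text \<open>For odd \<open>|v\<^sub>l|\<close> the divided power rule reduces to
  \<open>p = 1\<close>; for even \<open>|v\<^sub>l|\<close> the suspension is odd and only
  \<open>p = 1\<close> exists. There the error lies in
  \<open>\<Lambda>\<^sup>+V \<otimes> \<Gamma>\<^sup>+(sV)\<close>, hence has total word length at
  least 2.\<close>

lemma D_dpow:
  assumes l: "l < length V" and p: "0 < p" and g: "mpow l p \<in> mons (susp V)"
  shows "D (monom (mone, mpow l p) 1) - monom (mpow l 1, mpow l (p - 1)) 1 \<in> remainder V (p + 1)"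
proof -
  have V: "2 \<le> V ! l" using V2 l by simp
  have mp: "mpow l q \<in> mons (susp V)" if "q \<le> p" for q
    using g that by (auto simp: mons_def mpow_def)
  define R where "R = D (monom (mone, mpow l 1) 1) - monom (mpow l 1, mone) 1"
  have "\<forall>(m, g)\<in>Poly_Mapping.keys (D (tens lone (dpow l 1)) - tens (gen l) lone). m \<noteq> mone \<and> g \<noteq> mone"
    using acl l by (simp add: acyclic_closure_def)
  then have keysR: "\<forall>(m, g)\<in>Poly_Mapping.keys R. m \<noteq> mone \<and> g \<noteq> mone"
    by (simp add: R_def dpow_def lone_def gen_def)
  have "monom (mone, mpow l 1) 1 \<in> LamGam V" using mp[of 1] p by simp
  then have "D (monom (mone, mpow l 1) 1) \<in> LamGam V" by (rule D_lin)
  moreover have e: "monom (mpow l 1, mone) 1 \<in> LamGam V" using l by simp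
  ultimately have "R \<in> LamGam V"
    unfolding R_def using keys_diff[of "D (monom (mone, mpow l 1) 1)" "monom (mpow l 1, mone) 1"]
    by (fastforce simp: LamGam_def)
  then have R: "R \<in> remainder V 2"
    using keysR wlen_eq_0_iff[of _ V] wlen_eq_0_iff[of _ "susp V"]
    by (fastforce simp: remainder_def LamGam_def Suc_le_eq)
  show ?thesis
  proof (cases "odd (V ! l)")
    case True
    have "D (tens lone (dpow l p)) = pmult V (D (tens lone (dpow l 1))) (tens lone (dpow l (p - 1)))"
      using acl[unfolded acyclic_closure_def] l True p
      by (metis Suc_leI One_nat_def)
    then have "D (monom (mone, mpow l p) 1) = pmult V (R + monom (mpow l 1, mone) 1) (monom (mone, mpow l (p - 1)) 1)"
      by (simp add: lone_def dpow_def R_def)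
    also have "\<dots> = pmult V R (monom (mone, mpow l (p - 1)) 1) + monom (mpow l 1, mpow l (p - 1)) 1"
      using mp l by (simp add: pmult_add lamgam_coeff_def)
    finally have "D (monom (mone, mpow l p) 1) - monom (mpow l 1, mpow l (p - 1)) 1
       = pmult V R (monom (mone, mpow l (p - 1)) 1)" by simp
    moreover have "pmult V R (monom (mone, mpow l (p - 1)) 1) \<in> remainder V (2 + wlen V mone + wlen V (mpow l (p - 1)))"
      by (rule remainder_pmult_right[OF R])
    ultimately show ?thesis using l p by simp
  next
    case False
    then have "p = 1" using g l V p by (auto simp: mons_def mpow_def)
    then show ?thesis using R by (simp add: R_def numeral_2_eq_2)
  qed
qed

text \<open>The last divided power is split off and the Leibniz rule applied; multiplying an error
  term by the other factor adds exactly the word length of that factor.\<close>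

lemma D_leading_upto:
  assumes "l \<le> length V" "g \<in> mons (susp V)" "\<forall>j\<ge>l. g j = 0"
  shows "D (monom (mone, g) 1) - leading V g \<in> remainder V (wlen V g + 1)"
  using assms
proof (induction l arbitrary: g)
  case 0
  then have g: "g = mone" by (auto simp: mone_def)
  have "D (monom (mone, g) 1) = tens (d lone) lone"
    using D_tens_lone[of lone] by (simp add: g lone_def)
  moreover have "leading V g = 0" by (simp add: leading_def g mone_def)
  ultimately show ?case by (simp add: d_lone tens_lin)
next
  case (Suc l)
  show ?case
  proof (cases "g l = 0")
    case True
    then have "\<forall>j\<ge>l. g j = 0" using Suc.prems by (metis Suc_leI le_neq_implies_less)
    then show ?thesis using Suc by simp
  next
    case False
    define p where "p = g l"
    define g' where "g' = g(l := 0)"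
    have p: "0 < p" using False p_def by simp
    have l: "l < length V" using Suc.prems by simp
    have g0: "\<forall>j\<ge>l. g' j = 0" using Suc.prems(3) by (auto simp: g'_def)
    have g: "madd g' (mpow l p) = g" by (auto simp: g'_def p_def madd_def mpow_def)
    have gm: "g' \<in> mons (susp V)" "mpow l p \<in> mons (susp V)"
      using Suc.prems(2) g mons_maddD by metis+
    let ?x = "monom (mone, g') 1" and ?y = "monom (mone, mpow l p) 1"
    let ?e = "monom (mpow l 1, mpow l (p - 1)) 1"
    let ?s = "sg (int (mdeg (susp V) g'))"
    have gc: "gam_coeff V g' (mpow l p) = 1"
      using Suc.prems(2) g g0 by (intro gam_coeff_split) auto
    have mg': "madd g' (mpow l (p - 1)) = drop1 l g"
      using p by (auto simp: g'_def p_def madd_def mpow_def drop1_def)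
    then have gc': "gam_coeff V g' (mpow l (p - 1)) = 1"
      using Suc.prems(2) g0 by (intro gam_coeff_split) auto
    have "monom (mone, g) 1 = pmult V ?x ?y"
      using g gc by (simp add: lamgam_coeff_def)
    moreover have "phomog V (int (mdeg (susp V) g')) ?x" by (simp add: phomog_def)
    ultimately have "D (monom (mone, g) 1) = pmult V (D ?x) ?y + scal ?s (pmult V ?x (D ?y))"
      using D_leibniz[of ?x ?y] gm by simp
    also have "\<dots> = pmult V (leading V g') ?y + scal ?s (pmult V ?x ?e) +
        (pmult V (D ?x - leading V g') ?y + scal ?s (pmult V ?x (D ?y - ?e)))"
      by (simp add: pmult_diff scal_diff)
    finally have eq1: "D (monom (mone, g) 1) = pmult V (leading V g') ?y + scal ?s (pmult V ?x ?e) +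
        (pmult V (D ?x - leading V g') ?y + scal ?s (pmult V ?x (D ?y - ?e)))" .
    \<comment> \<open>The first product gives the summands \<open>i < l\<close>, the second one the
      summand \<open>i = l\<close>.\<close>
    have "leading V g = pmult V (leading V g') ?y + scal ?s (pmult V ?x ?e)"
    proof -
      let ?I = "{i. i < length V \<and> 0 < g' i}"
      have I: "{i. i < length V \<and> 0 < g i} = insert l ?I" "l \<notin> ?I" "finite ?I"
        using l p by (auto simp: g'_def p_def)
      have "pmult V (leading V g') ?y = (\<Sum>i\<in>?I. monom (mpow i 1, drop1 i g) (dsign V i g))"
        unfolding leading_def pmult_sum_left
      proof (intro sum.cong refl)
        fix i assume i: "i \<in> ?I"
        then have il: "i < l" using g0 not_less by auto
        have "dsign V i g' = dsign V i g"
          unfolding dsign_def using il by (auto simp: g'_def intro!: arg_cong[of _ _ sg] sum.cong)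
        moreover have m: "madd (drop1 i g') (mpow l p) = drop1 i g"
          using il by (auto simp: g'_def p_def madd_def mpow_def drop1_def)
        moreover have "gam_coeff V (drop1 i g') (mpow l p) = 1"
        proof (rule gam_coeff_split)
          show "\<forall>j\<ge>l. drop1 i g' j = 0" using g0 by (simp add: drop1_def)
          show "madd (drop1 i g') (mpow l p) \<in> mons (susp V)" unfolding m using Suc.prems(2) by simp
        qed
        ultimately show "pmult V (monom (mpow i 1, drop1 i g') (dsign V i g')) ?y = monom (mpow i 1, drop1 i g) (dsign V i g)"
          using i by (simp add: lamgam_coeff_def)
      qed
      moreover have "scal ?s (pmult V ?x ?e) = monom (mpow l 1, drop1 l g) (dsign V l g)"
      proof -
        have "(\<Sum>j<l. int (g' j) * (int (V ! j) - 1)) = (\<Sum>j<l. int (g j) * (int (V ! j) - 1))"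
          by (intro sum.cong) (auto simp: g'_def)
        then have md: "int (mdeg (susp V) g') = (\<Sum>j<l. int (g j) * (int (V ! j) - 1))"
          using mdeg_susp_upto[OF g0 _ V1] l by simp
        have "pmult V ?x ?e = monom (mpow l 1, drop1 l g) (sg (int (mdeg (susp V) g' * V ! l)))"
          using mg' gc' l by (simp add: lamgam_coeff_def power_sg)
        then show ?thesis
          by (simp add: dsign_def sg_add[symmetric] md algebra_simps)
      qed
      ultimately show ?thesis
        unfolding leading_def I(1) using I(2,3) by (simp add: add.commute)
    qed
    with eq1 have "D (monom (mone, g) 1) - leading V g =
       pmult V (D ?x - leading V g') ?y + scal ?s (pmult V ?x (D ?y - ?e))" by simp
    moreover have wl: "wlen V g = wlen V g' + p" using l by (subst g[symmetric]) simp
    have "pmult V (D ?x - leading V g') ?y \<in> remainder V (wlen V g' + 1 + wlen V mone + wlen V (mpow l p))"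
      by (intro remainder_pmult_right Suc.IH) (use gm g0 l in auto)
    moreover have "pmult V ?x (D ?y - ?e) \<in> remainder V (p + 1 + wlen V mone + wlen V g')"
      by (intro remainder_pmult_left D_dpow) (use gm l p in auto)
    ultimately show ?thesis using wl l by (simp add: remainder_add remainder_scal add_ac)
  qed
qed

lemma D_leading:
  assumes "g \<in> mons (susp V)"
  shows "D (monom (mone, g) 1) - leading V g \<in> remainder V (wlen V g + 1)"
  using assms by (intro D_leading_upto[of "length V"]) (auto simp: mons_def)

end

section \<open>Module maps and their coefficients\<close>

definition coef :: "(lamgam \<Rightarrow> lam) \<Rightarrow> mono \<Rightarrow> mono \<Rightarrow> rat" where
  "coef f m g = Poly_Mapping.lookup (f (monom (mone, g) 1)) m"

text \<open>
  For \<open>f \<in> F^p\<close>: the part of \<open>f\<close> of word length exactly \<open>p\<close> is zero on divided power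
  monomials of word length at least \<open>N\<close>.
\<close>

definition vanish :: "nat list \<Rightarrow> int \<Rightarrow> nat \<Rightarrow> (lamgam \<Rightarrow> lam) \<Rightarrow> bool" where
  "vanish V p N f \<longleftrightarrow>
     (\<forall>g\<in>mons (susp V). N \<le> wlen V g \<longrightarrow> f (monom (mone, g) 1) \<in> Lam_ge V (p + 1))"

lemma Hom_deg_linear: "f \<in> Hom_deg V q \<Longrightarrow> linear_between (LamGam V) (Lam V) f"
  by (simp add: Hom_deg_def)

lemmas Hom_lin = linear_betweenD[OF Hom_deg_linear]

lemma Hom_deg_zero_arg [simp]: "f \<in> Hom_deg V q \<Longrightarrow> f 0 = 0"
  using linear_between_zero[OF Hom_deg_linear] by simp

lemma Hom_deg_homog: "f \<in> Hom_deg V q \<Longrightarrow> x \<in> LamGam V \<Longrightarrow> phomog V j x \<Longrightarrow> lhomog V (j + q) (f x)"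
  by (simp add: Hom_deg_def)

lemma Hom_deg_module: "f \<in> Hom_deg V q \<Longrightarrow> a \<in> Lam V \<Longrightarrow> x \<in> LamGam V \<Longrightarrow> lhomog V j a \<Longrightarrow>
    f (pmult V (tens a lone) x) = scal (sg (q * j)) (lmult V a (f x))"
  by (simp add: Hom_deg_def powi_sg)

lemma Hom_degI:
  assumes "linear_between (LamGam V) (Lam V) f"
    and "\<And>x j. x \<in> LamGam V \<Longrightarrow> phomog V j x \<Longrightarrow> lhomog V (j + q) (f x)"
    and "\<And>a x j. a \<in> Lam V \<Longrightarrow> x \<in> LamGam V \<Longrightarrow> lhomog V j a \<Longrightarrow>
       f (pmult V (tens a lone) x) = scal (sg (q * j)) (lmult V a (f x))"
  shows "f \<in> Hom_deg V q"
  using assms by (simp add: Hom_deg_def powi_sg)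

lemma Hom_deg_cong:
  assumes "f \<in> Hom_deg V q" "\<And>x. x \<in> LamGam V \<Longrightarrow> h x = f x"
  shows "h \<in> Hom_deg V q"
  using assms(1) unfolding Hom_deg_def linear_between_def by (simp add: assms(2))

lemma Hom_deg_add:
  assumes "f \<in> Hom_deg V q" "h \<in> Hom_deg V q"
  shows "(\<lambda>x. f x + h x) \<in> Hom_deg V q"
proof (rule Hom_degI)
  show "linear_between (LamGam V) (Lam V) (\<lambda>x. f x + h x)"
    using assms by (simp add: linear_between_def Hom_lin scal_add algebra_simps)
qed (use assms in \<open>auto simp: Hom_deg_homog Hom_deg_module lhomog_simps lmult_add scal_add\<close>)

lemma Hom_deg_scal:
  assumes "f \<in> Hom_deg V q"
  shows "(\<lambda>x. scal c (f x)) \<in> Hom_deg V q"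
proof (rule Hom_degI)
  show "linear_between (LamGam V) (Lam V) (\<lambda>x. scal c (f x))"
    using assms by (simp add: linear_between_def Hom_lin scal_add mult.commute)
qed (use assms in \<open>auto simp: Hom_deg_homog Hom_deg_module lhomog_simps lmult_add mult.commute\<close>)

lemma Hom_deg_single:
  assumes "f \<in> Hom_deg V q" "a \<in> mons V" "g \<in> mons (susp V)"
  shows "f (monom (a, g) c) =
    scal (c * sg (q * int (mdeg V a))) (lmult V (monom a 1) (f (monom (mone, g) 1)))"
proof -
  have "f (monom (a, g) c) = scal c (f (monom (a, g) 1))"
    using assms by (intro linear_between_single[OF Hom_deg_linear]) auto
  also have "monom (a, g) 1 = pmult V (tens (monom a 1) lone) (monom (mone, g) 1)"
    using assms by simp
  also have "f \<dots> = scal (sg (q * int (mdeg V a))) (lmult V (monom a 1) (f (monom (mone, g) 1)))"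
    using assms by (intro Hom_deg_module) (auto simp: lhomog_def)
  finally show ?thesis by simp
qed

lemma Filt_iff:
  "f \<in> Filt V p q \<longleftrightarrow> f \<in> Hom_deg V q \<and> (\<forall>g\<in>mons (susp V). f (monom (mone, g) 1) \<in> Lam_ge V p)"
proof
  assume f: "f \<in> Filt V p q"
  have "f (monom (mone, g) 1) \<in> Lam_ge V p" if "g \<in> mons (susp V)" for g
  proof -
    have "monom g 1 \<in> Gam V" using that by (simp add: Gam_def)
    then have "f (tens lone (monom g 1)) \<in> Lam_ge V p" using f by (simp add: Filt_def)
    then show ?thesis by (simp add: lone_def)
  qed
  then show "f \<in> Hom_deg V q \<and> (\<forall>g\<in>mons (susp V). f (monom (mone, g) 1) \<in> Lam_ge V p)"
    using f by (simp add: Filt_def)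
next
  assume f: "f \<in> Hom_deg V q \<and> (\<forall>g\<in>mons (susp V). f (monom (mone, g) 1) \<in> Lam_ge V p)"
  \<comment> \<open>Membership is carried through the induction because \<open>f\<close> is additive
    only on the carrier.\<close>
  have "tens lone b \<in> LamGam V \<and> f (tens lone b) \<in> Lam_ge V p" if "b \<in> Gam V" for b
    using that unfolding Gam_def mem_Collect_eq
  proof (induction b rule: keys_linear_induct)
    case zero
    show ?case using Hom_deg_zero_arg[OF conjunct1[OF f]] by (simp add: tens_lin lam_ge_simps)
  next
    case (single k c)
    have "f (monom (mone, k) c) = scal c (f (monom (mone, k) 1))"
      using single by (intro linear_between_single[OF Hom_deg_linear[OF conjunct1[OF f]]]) simp
    moreover have "f (monom (mone, k) 1) \<in> Lam_ge V p" using f single by simp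
    ultimately have "f (monom (mone, k) c) \<in> Lam_ge V p" by (metis lam_ge_simps(3))
    then show ?case using single by (simp add: lone_def)
  next
    case (add x y)
    then show ?case by (simp add: tens_lin Hom_lin[OF conjunct1[OF f]] lam_ge_simps)
  qed
  then show "f \<in> Filt V p q" using f by (simp add: Filt_def)
qed

lemma Filt_Hom: "f \<in> Filt V p q \<Longrightarrow> f \<in> Hom_deg V q"
  by (simp add: Filt_iff)

lemma Filt_mono: "f \<in> Filt V p q \<Longrightarrow> p' \<le> p \<Longrightarrow> f \<in> Filt V p' q"
  using lam_ge_mono by (auto simp: Filt_iff)

lemma Filt_cong: "f \<in> Filt V p q \<Longrightarrow> (\<And>x. x \<in> LamGam V \<Longrightarrow> h x = f x) \<Longrightarrow> h \<in> Filt V p q"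
  using Hom_deg_cong[of f V q h] by (simp add: Filt_iff)

lemma Filt_add: "f \<in> Filt V p q \<Longrightarrow> h \<in> Filt V p q \<Longrightarrow> (\<lambda>x. f x + h x) \<in> Filt V p q"
  by (simp add: Filt_iff Hom_deg_add lam_ge_simps)

lemma Filt_diff: 
  assumes "f \<in> Filt V p q" "h \<in> Filt V p q"
  shows "(\<lambda>x. f x - h x) \<in> Filt V p q"
proof -
  have "(\<lambda>x. f x + scal (-1) (h x)) \<in> Filt V p q"
    using assms by (simp add: Filt_iff Hom_deg_add Hom_deg_scal lam_ge_simps)
  then show ?thesis by (simp add: scal_minus_one)
qed

lemma Filt_zero: "(\<lambda>x. 0) \<in> Filt V p q"
proof -
  have "(\<lambda>x. 0) \<in> Hom_deg V q"
    by (rule Hom_degI) (auto simp: linear_between_def lhomog_simps lmult_add)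
  then show ?thesis by (simp add: Filt_iff lam_ge_simps)
qed

lemma vanish_0: "f \<in> Hom_deg V q \<Longrightarrow> vanish V p 0 f \<Longrightarrow> f \<in> Filt V (p + 1) q"
  by (simp add: Filt_iff vanish_def)

lemma Filt_vanish: "f \<in> Filt V (p + 1) q \<Longrightarrow> vanish V p N f"
  by (simp add: Filt_iff vanish_def)

lemma vanish_mono: "vanish V p N f \<Longrightarrow> N \<le> N' \<Longrightarrow> vanish V p N' f"
  by (auto simp: vanish_def)

lemma vanish_add: "vanish V p N f \<Longrightarrow> vanish V p N h \<Longrightarrow> vanish V p N (\<lambda>x. f x + h x)"
  by (simp add: vanish_def lam_ge_simps)

lemma vanish_cong: "vanish V p N f \<Longrightarrow> (\<And>x. x \<in> LamGam V \<Longrightarrow> h x = f x) \<Longrightarrow> vanish V p N h"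
  by (simp add: vanish_def)

lemma vanishI:
  assumes "f \<in> Filt V p q"
    and "\<And>m g. m \<in> mons V \<Longrightarrow> g \<in> mons (susp V) \<Longrightarrow> int (wlen V m) = p \<Longrightarrow> N \<le> wlen V g \<Longrightarrow> coef f m g = 0"
  shows "vanish V p N f"
  unfolding vanish_def
proof (intro ballI impI)
  fix g assume g: "g \<in> mons (susp V)" "N \<le> wlen V g"
  have *: "f (monom (mone, g) 1) \<in> Lam_ge V p" using assms(1) g by (simp add: Filt_iff)
  have "p + 1 \<le> int (wlen V m)" if m: "m \<in> Poly_Mapping.keys (f (monom (mone, g) 1))" for m
  proof -
    have "m \<in> mons V" "p \<le> int (wlen V m)" using * m by (auto simp: Lam_ge_def Lam_def)
    moreover have "coef f m g \<noteq> 0" using m by (simp add: coef_def in_keys_iff)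
    ultimately show ?thesis using assms(2)[of m g] g by fastforce
  qed
  then show "f (monom (mone, g) 1) \<in> Lam_ge V (p + 1)" using * by (simp add: Lam_ge_def)
qed

lemma vanish_coef:
  "vanish V p N f \<Longrightarrow> g \<in> mons (susp V) \<Longrightarrow> N \<le> wlen V g \<Longrightarrow> int (wlen V m) \<le> p \<Longrightarrow> coef f m g = 0"
  unfolding vanish_def coef_def by (intro lam_ge_lookup[of _ V "p + 1"]) auto

lemma coef_degree:
  assumes "f \<in> Hom_deg V q" "g \<in> mons (susp V)" "coef f m g \<noteq> 0"
  shows "int (mdeg V m) = int (mdeg (susp V) g) + q"
proof -
  have "lhomog V (int (mdeg (susp V) g) + q) (f (monom (mone, g) 1))"
    using assms by (intro Hom_deg_homog) (auto simp: phomog_def)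
  then show ?thesis using assms(3) by (simp add: lhomog_def coef_def in_keys_iff)
qed

lemma mdeg_le_wlen: "mdeg V m \<le> wlen V m * sum_list V"
proof -
  have "mdeg V m \<le> (\<Sum>i<length V. m i * sum_list V)"
    unfolding mdeg_def by (intro sum_mono mult_left_mono) (auto simp: member_le_sum_list)
  then show ?thesis by (simp add: wlen_def sum_distrib_right)
qed

lemma wlen_le_mdeg_susp:
  assumes "\<forall>k\<in>set V. 2 \<le> k"
  shows "wlen V g \<le> mdeg (susp V) g"
proof -
  have "g i * 1 \<le> g i * (V ! i - 1)" if "i < length V" for i
  proof -
    have "2 \<le> V ! i" using assms that by simp
    then show ?thesis by (intro mult_left_mono) auto
  qed
  then show ?thesis by (auto simp: mdeg_def wlen_def intro!: sum_mono)
qed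

text \<open>A non-zero coefficient has \<open>|g| = |m| - q\<close>, where \<open>|m|\<close> is
  bounded through the word length \<open>p\<close>. As every \<open>|sv\<^sub>i|\<close> is at least
  1, by \<open>V = V^(\<ge>2)\<close>, this bounds the word length of \<open>g\<close>.\<close>

lemma vanish_exists:
  assumes "f \<in> Filt V p q" "\<forall>k\<in>set V. 2 \<le> k"
  shows "\<exists>N. vanish V p N f"
proof
  show "vanish V p (nat (p * int (sum_list V) - q) + 1) f"
  proof (rule vanishI[OF assms(1)], rule ccontr)
    fix m g assume m: "m \<in> mons V" "g \<in> mons (susp V)" "int (wlen V m) = p"
      "nat (p * int (sum_list V) - q) + 1 \<le> wlen V g" and nz: "coef f m g \<noteq> 0"
    have "int (mdeg V m) = int (mdeg (susp V) g) + q"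
      using coef_degree[OF Filt_Hom[OF assms(1)] m(2) nz] .
    moreover have "int (mdeg V m) \<le> p * int (sum_list V)"
      using mdeg_le_wlen[of V m] m(3) by (metis of_nat_le_iff of_nat_mult)
    moreover have "wlen V g \<le> mdeg (susp V) g" by (rule wlen_le_mdeg_susp[OF assms(2)])
    ultimately show False using m(4) by linarith
  qed
qed

lemma finite_wlen: "finite {m \<in> mons V. wlen V m = n}"
proof (rule finite_subset)
  show "{m \<in> mons V. wlen V m = n} \<subseteq>
     {m. \<forall>i. (i \<in> {..<length V} \<longrightarrow> m i \<in> {..n}) \<and> (i \<notin> {..<length V} \<longrightarrow> m i = 0)}"
    by (auto simp: mons_def wlen_def intro: member_le_sum)
  show "finite {m. \<forall>i. (i \<in> {..<length V} \<longrightarrow> m i \<in> {..n}) \<and> (i \<notin> {..<length V} \<longrightarrow> m i = (0::nat))}"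
    by (intro finite_set_of_finite_funs) auto
qed

section \<open>Module maps with prescribed values on divided power monomials\<close>

definition lincomb :: "('k \<Rightarrow> ('m \<Rightarrow>\<^sub>0 rat)) \<Rightarrow> ('k \<Rightarrow>\<^sub>0 rat) \<Rightarrow> ('m \<Rightarrow>\<^sub>0 rat)" where
  "lincomb T x = (\<Sum>k\<in>Poly_Mapping.keys x. scal (Poly_Mapping.lookup x k) (T k))"

lemma lincomb_superset:
  assumes "finite A" "Poly_Mapping.keys x \<subseteq> A"
  shows "lincomb T x = (\<Sum>k\<in>A. scal (Poly_Mapping.lookup x k) (T k))"
  unfolding lincomb_def using assms by (intro sum.mono_neutral_left) (auto simp: in_keys_iff)

lemma lincomb_add: "lincomb T (x + y) = lincomb T x + lincomb T y"
  using keys_add[of x y]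
  by (subst (1 2 3) lincomb_superset[of "Poly_Mapping.keys x \<union> Poly_Mapping.keys y"])
     (auto simp: lookup_add scal_add_left sum.distrib)

lemma lincomb_scal: "lincomb T (scal c x) = scal c (lincomb T x)"
  using keys_scal[of c x]
  by (subst (1 2) lincomb_superset[of "Poly_Mapping.keys x"]) (auto simp: scal_sum)

lemma lincomb_single [simp]: "lincomb T (monom k c) = scal c (T k)"
  by (subst lincomb_superset[of "{k}"]) auto

lemma lincomb_zero [simp]: "lincomb T 0 = 0"
  by (simp add: lincomb_def)

lemma lincomb_closed:
  assumes "\<And>k. k \<in> Poly_Mapping.keys x \<Longrightarrow> P (T k)" "P 0"
    and "\<And>a b. P a \<Longrightarrow> P b \<Longrightarrow> P (a + b)" "\<And>c a. P a \<Longrightarrow> P (scal c a)"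
  shows "P (lincomb T x)"
proof -
  have "P (\<Sum>k\<in>K. scal (Poly_Mapping.lookup x k) (T k))" if "K \<subseteq> Poly_Mapping.keys x" for K
    using finite_subset[OF that finite_keys] that
    by (induction K rule: finite_induct) (auto simp: assms)
  then show ?thesis by (simp add: lincomb_def)
qed

text \<open>\<open>\<Lambda>V \<otimes> \<Gamma>(sV)\<close> is free over \<open>\<Lambda>V\<close>
  on the monomials of \<open>\<Gamma>(sV)\<close>; the sign is that of a map of degree
  \<open>q\<close> passing the coefficient.\<close>

definition extend :: "nat list \<Rightarrow> int \<Rightarrow> (mono \<Rightarrow> lam) \<Rightarrow> lamgam \<Rightarrow> lam" where
  "extend V q F = lincomb (\<lambda>k. scal (sg (q * int (mdeg V (fst k)))) (lmult V (monom (fst k) 1) (F (snd k))))"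

lemma extend_one: "F g \<in> Lam V \<Longrightarrow> extend V q F (monom (mone, g) 1) = F g"
  by (simp add: extend_def lone_def[symmetric])

lemma extend_Hom:
  assumes F: "\<And>g. g \<in> mons (susp V) \<Longrightarrow> lhomog V (int (mdeg (susp V) g) + q) (F g)"
  shows "extend V q F \<in> Hom_deg V q"
proof (rule Hom_degI)
  show "linear_between (LamGam V) (Lam V) (extend V q F)"
    unfolding linear_between_def extend_def
    by (auto simp: lincomb_add lincomb_scal intro!: lincomb_closed[where P = "\<lambda>a. a \<in> Lam V"])
next
  fix x j assume x: "x \<in> LamGam V" "phomog V j x"
  show "lhomog V (j + q) (extend V q F x)"
    unfolding extend_def
  proof (rule lincomb_closed)
    fix k assume k: "k \<in> Poly_Mapping.keys x"
    obtain a g where [simp]: "k = (a, g)" by (cases k)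
    have g: "g \<in> mons (susp V)" and j: "j = int (mdeg V a) + int (mdeg (susp V) g)"
      using k x by (auto simp: LamGam_def phomog_def)
    have "lhomog V (int (mdeg V a) + (int (mdeg (susp V) g) + q)) (lmult V (monom a 1) (F g))"
      by (rule lhomog_lmult[OF _ F[OF g]]) (simp add: lhomog_def)
    then show "lhomog V (j + q) (scal (sg (q * int (mdeg V (fst k)))) (lmult V (monom (fst k) 1) (F (snd k))))"
      by (auto simp: j add_ac intro: lhomog_simps)
  qed (auto intro: lhomog_simps)
next
  fix a x j assume a: "a \<in> Lam V" "lhomog V j a" and x: "x \<in> LamGam V"
  have "Poly_Mapping.keys a \<subseteq> {m \<in> mons V. int (mdeg V m) = j}"
    using a by (auto simp: Lam_def lhomog_def)
  then show "extend V q F (pmult V (tens a lone) x) = scal (sg (q * j)) (lmult V a (extend V q F x))"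
  proof (induction a rule: keys_linear_induct)
    case zero
    then show ?case by (simp add: tens_lin pmult_add lmult_add extend_def)
  next
    case (add b c)
    then show ?case by (simp add: tens_lin pmult_add lmult_add extend_def lincomb_add scal_add)
  next
    case (single m c)
    then have j: "j = int (mdeg V m)" by simp
    show ?case using x unfolding LamGam_def mem_Collect_eq
    proof (induction x rule: keys_linear_induct)
      case zero
      then show ?case by (simp add: pmult_add lmult_add extend_def)
    next
      case (add x y)
      then show ?case by (simp add: pmult_add lmult_add extend_def lincomb_add scal_add)
    next
      case (single k t)
      obtain b g where [simp]: "k = (b, g)" by (cases k)
      have g: "g \<in> mons (susp V)" using single by simp
      have "lmult V (monom a c) y = scal c (lmult V (monom a 1) y)" for a y
        using lmult_add(3)[of V c "monom a 1" y] by simp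
      then show ?case using g
        by (simp add: extend_def lmult_add lmult_assoc_single lincomb_scal j sg_add algebra_simps)
    qed
  qed
qed

lemma lookup_lmult_gen:
  assumes "m \<in> mons V"
  shows "Poly_Mapping.lookup (lmult V (monom (mpow i 1) 1) y) m =
    (if 0 < m i then lam_coeff V (mpow i 1) (drop1 i m) * Poly_Mapping.lookup y (drop1 i m) else 0)"
proof -
  have "Poly_Mapping.keys y \<subseteq> UNIV" by simp
  then show ?thesis
  proof (induction y rule: keys_linear_induct)
    case zero
    then show ?case by (simp add: lmult_add)
  next
    case (add x y)
    then show ?case by (simp add: lmult_add lookup_add algebra_simps)
  next
    case (single k c)
    have "madd (mpow i 1) k = m \<longleftrightarrow> 0 < m i \<and> k = drop1 i m"
      by (auto simp: madd_def mpow_def drop1_def fun_eq_iff)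
    then show ?case by (auto simp: lookup_single when_def)
  qed
qed

text \<open>This is the origin of the last sum in \<open>ksign\<close>.\<close>

lemma lam_coeff_gen:
  assumes "m \<in> mons V" "0 < m i" "i < length V"
  shows "lam_coeff V (mpow i 1) (drop1 i m) = sg (int (V ! i) * (\<Sum>j<i. int (m j) * int (V ! j)))"
proof -
  have "madd (mpow i 1) (drop1 i m) = m"
    using assms(2) by (auto simp: madd_def mpow_def drop1_def)
  moreover have "lexp V (mpow i 1) (drop1 i m) = V ! i * (\<Sum>j<i. m j * V ! j)"
  proof -
    have "lexp V (mpow i 1) (drop1 i m) = (\<Sum>j<length V. if j = i then V ! i * (\<Sum>k<i. m k * V ! k) else 0)"
      unfolding lexp_def by (intro sum.cong refl) (auto simp: mpow_def drop1_def sum_distrib_left intro!: sum.cong)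
    then show ?thesis using assms(3) by simp
  qed
  ultimately show ?thesis using assms(1) by (simp add: lam_coeff_lexp)
qed

section \<open>The differential on module maps and its leading part\<close>

context minimal_closure
begin

lemma Hom_diff_sg: "Hom_diff d D q f x = d (f x) + scal (sg (q + 1)) (f (D x))"
  by (simp add: Hom_diff_def powi_sg)

lemma Hom_diff_Hom:
  assumes f: "f \<in> Hom_deg V q"
  shows "Hom_diff d D q f \<in> Hom_deg V (q + 1)"
proof (rule Hom_degI)
  show "linear_between (LamGam V) (Lam V) (Hom_diff d D q f)"
    using f by (auto simp: linear_between_def Hom_diff_sg Hom_lin d_lin D_lin scal_add mult_ac)
next
  fix x j assume x: "x \<in> LamGam V" "phomog V j x"
  have "lhomog V (j + q + 1) (d (f x))" "lhomog V (j + 1 + q) (f (D x))"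
    using d_homog Hom_deg_homog[OF f] D_homog x D_lin(1) Hom_lin(1)[OF f] by auto
  then show "lhomog V (j + (q + 1)) (Hom_diff d D q f x)"
    by (auto simp: Hom_diff_sg add_ac intro!: lhomog_simps)
next
  fix a x j assume a: "a \<in> Lam V" "lhomog V j a" and x: "x \<in> LamGam V"
  have ph: "phomog V j (tens a lone)"
    using a(2) by (fastforce simp: phomog_def lhomog_def in_keys_iff lone_def lookup_single when_def split: if_splits)
  have "D (pmult V (tens a lone) x) = pmult V (tens (d a) lone) x + scal (sg j) (pmult V (tens a lone) (D x))"
    using D_leibniz[OF tens_lone_LamGam[OF a(1)] x ph] a D_tens_lone by simp
  then have "f (D (pmult V (tens a lone) x)) = scal (sg (q * (j + 1))) (lmult V (d a) (f x))
     + scal (sg j * sg (q * j)) (lmult V a (f (D x)))"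
    using Hom_deg_module[OF f _ _ d_homog[OF a]] Hom_deg_module[OF f _ _ a(2)] a x
    by (simp add: Hom_lin[OF f] d_lin D_lin)
  moreover have "d (f (pmult V (tens a lone) x)) = scal (sg (q * j)) (lmult V (d a) (f x))
     + scal (sg (q * j) * sg j) (lmult V a (d (f x)))"
    using Hom_deg_module[OF f a(1) x a(2)] d_leibniz[OF a(1) Hom_lin(1)[OF f x] a(2)]
    by (simp add: d_lin scal_add)
  \<comment> \<open>The terms containing \<open>d a\<close> from \<open>d \<circ> f\<close> and from
    \<open>f \<circ> D\<close> cancel, since \<open>(q + 1) + q (j + 1)\<close> and
    \<open>q j\<close> differ by an odd number.\<close>
  moreover have "scal (sg (q + 1) * sg (q * (j + 1))) z = - scal (sg (q * j)) z" for z :: lam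
    by (rule poly_mapping_eqI) (auto simp: sg_def)
  moreover have "sg (q + 1) * (sg j * sg (q * j)) = sg ((q + 1) * j) * sg (q + 1)"
    "sg (q * j) * sg j = sg ((q + 1) * j)"
    by (auto simp: sg_def)
  ultimately show "Hom_diff d D q f (pmult V (tens a lone) x) =
     scal (sg ((q + 1) * j)) (lmult V a (Hom_diff d D q f x))"
    by (simp add: Hom_diff_sg scal_add lmult_add mult.commute)
qed

lemma Hom_diff_square:
  assumes f: "f \<in> Hom_deg V q" and x: "x \<in> LamGam V"
  shows "Hom_diff d D (q + 1) (Hom_diff d D q f) x = 0"
proof -
  have "sg (q + 1 + 1) = - sg (q + 1)" by (auto simp: sg_def)
  moreover have "d (d (f x)) = 0" by (rule d_d) (rule Hom_lin(1)[OF f x])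
  ultimately show ?thesis
    using f x by (simp add: Hom_diff_sg d_lin Hom_lin[OF f] D_lin D_D scal_add)
      (rule poly_mapping_eqI, simp add: lookup_add)
qed

lemma Hom_diff_add:
  "f \<in> Hom_deg V q \<Longrightarrow> h \<in> Hom_deg V q \<Longrightarrow> x \<in> LamGam V \<Longrightarrow>
   Hom_diff d D q (\<lambda>x. f x + h x) x = Hom_diff d D q f x + Hom_diff d D q h x"
  by (simp add: Hom_diff_sg d_lin Hom_lin D_lin scal_add)

lemma Hom_diff_minus:
  assumes "f \<in> Hom_deg V q" "h \<in> Hom_deg V q" "x \<in> LamGam V"
  shows "Hom_diff d D q (\<lambda>x. f x - h x) x = Hom_diff d D q f x - Hom_diff d D q h x"
proof -
  have "Hom_diff d D q (\<lambda>x. f x + scal (-1) (h x)) x = Hom_diff d D q f x + Hom_diff d D q (\<lambda>x. scal (-1) (h x)) x"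
    by (intro Hom_diff_add Hom_deg_scal assms)
  also have "Hom_diff d D q (\<lambda>x. scal (-1) (h x)) x = scal (-1) (Hom_diff d D q h x)"
    using assms by (simp add: Hom_diff_sg d_lin Hom_lin D_lin scal_add mult.commute)
  finally show ?thesis by (simp add: scal_minus_one)
qed

text \<open>A term with one factor from \<open>V\<close> has a divided power monomial of length at
  least \<open>N\<close>, where \<open>f\<close> gains one word length by \<open>vanish\<close>; a
  term with two or more factors brings the gain itself.\<close>

lemma Hom_remainder:
  assumes f: "f \<in> Filt V p q" and N: "vanish V p N f" and x: "x \<in> remainder V (N + 1)"
  shows "f x \<in> Lam_ge V (p + 2)"
proof -
  have "Poly_Mapping.keys x \<subseteq> {(m, g). m \<in> mons V \<and> g \<in> mons (susp V) \<and> 1 \<le> wlen V m \<and> N + 1 \<le> wlen V m + wlen V g}"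
    using x by (fastforce simp: remainder_def LamGam_def)
  then show ?thesis
  proof (induction x rule: keys_linear_induct)
    case zero
    then show ?case using Filt_Hom[OF f] by (simp add: lam_ge_simps)
  next
    case (add x y)
    then have "x \<in> LamGam V" "y \<in> LamGam V" by (auto simp: LamGam_def)
    then show ?case using add Filt_Hom[OF f] by (simp add: Hom_lin lam_ge_simps)
  next
    case (single k c)
    obtain m g where k: "k = (m, g)" by (cases k)
    have m: "m \<in> mons V" "g \<in> mons (susp V)" "1 \<le> wlen V m" "N + 1 \<le> wlen V m + wlen V g"
      using single by (auto simp: k)
    have mm: "monom m 1 \<in> Lam_ge V (int (wlen V m))" using m by (simp add: Lam_ge_def)
    have "lmult V (monom m 1) (f (monom (mone, g) 1)) \<in> Lam_ge V (p + 2)"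
    proof (cases "wlen V m = 1")
      case True
      then have "f (monom (mone, g) 1) \<in> Lam_ge V (p + 1)" using N m by (simp add: vanish_def)
      from lam_ge_lmult[OF mm this] show ?thesis using True by (simp add: add_ac)
    next
      case False
      have "f (monom (mone, g) 1) \<in> Lam_ge V p" using f m by (simp add: Filt_iff)
      from lam_ge_lmult[OF mm this] show ?thesis by (rule lam_ge_mono) (use False m in auto)
    qed
    then show ?case using Hom_deg_single[OF Filt_Hom[OF f] m(1,2)] by (simp add: k lam_ge_simps)
  qed
qed

lemma leading_remainder:
  assumes "g \<in> mons (susp V)"
  shows "leading V g \<in> remainder V (wlen V g)"
proof -
  have mon: "monom (mpow i 1, drop1 i g) c \<in> remainder V (wlen V g)" if "i < length V" "0 < g i" for i c
  proof -
    have "g = madd (mpow i 1) (drop1 i g)"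
      using that by (auto simp: madd_def mpow_def drop1_def)
    then have "wlen V g = 1 + wlen V (drop1 i g)" using that by (metis wlen_madd wlen_mpow)
    then show ?thesis using that assms by (simp add: remainder_def)
  qed
  have "(\<Sum>i\<in>I. monom (mpow i 1, drop1 i g) (dsign V i g)) \<in> remainder V (wlen V g)"
    if "finite I" "I \<subseteq> {i. i < length V \<and> 0 < g i}" for I
    using that
  proof (induction I rule: finite_induct)
    case (insert i I)
    then show ?case using mon[of i "dsign V i g"] remainder_add by simp
  qed simp
  from this[of "{i. i < length V \<and> 0 < g i}"]
  show ?thesis unfolding leading_def by simp
qed

lemma remainder_mono: "x \<in> remainder V n \<Longrightarrow> n' \<le> n \<Longrightarrow> x \<in> remainder V n'"
  by (fastforce simp: remainder_def)

text \<open>The triangularity: for \<open>g\<close> of length at least \<open>N\<close>,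
  \<open>f\<close> takes \<open>g\<close> into word length \<open>p + 1\<close>, so \<open>d\<close>
  moves it to \<open>p + 2\<close>, and the error of \<open>D\<close> lands there as well. In word
  length \<open>p + 1\<close> only the Koszul term is left.\<close>

lemma Hom_diff_coef:
  assumes f: "f \<in> Filt V p q" and N: "vanish V p N f"
    and g: "g \<in> mons (susp V)" "N \<le> wlen V g" and m: "m \<in> mons V" "int (wlen V m) = p + 1"
  shows "coef (Hom_diff d D q f) m g = koszul V q (coef f) m g"
proof -
  note fH = Filt_Hom[OF f]
  define R where "R = D (monom (mone, g) 1) - leading V g"
  let ?I = "{i. i < length V \<and> 0 < g i}"
  have R: "R \<in> remainder V (N + 1)"
    unfolding R_def by (rule remainder_mono[OF D_leading]) (use g in auto)
  have "f (monom (mone, g) 1) \<in> Lam_ge V (p + 1)" using N g by (simp add: vanish_def)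
  from d_ge[OF this] have 1: "Poly_Mapping.lookup (d (f (monom (mone, g) 1))) m = 0"
    by (rule lam_ge_lookup) (use m in simp)
  have 2: "Poly_Mapping.lookup (f R) m = 0"
    by (rule lam_ge_lookup[OF Hom_remainder[OF f N R]]) (use m in simp)
  have LG: "leading V g \<in> LamGam V" "R \<in> LamGam V"
    using leading_remainder[OF g(1)] R by (auto simp: remainder_def)
  have fs: "f (\<Sum>i\<in>I. monom (mpow i 1, drop1 i g) (dsign V i g)) = (\<Sum>i\<in>I. f (monom (mpow i 1, drop1 i g) (dsign V i g)))
     \<and> (\<Sum>i\<in>I. monom (mpow i 1, drop1 i g) (dsign V i g)) \<in> LamGam V"
    if "finite I" "I \<subseteq> ?I" for I
    using that g by (induction I rule: finite_induct) (auto simp: Hom_deg_zero_arg[OF fH] Hom_lin[OF fH])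
  have "Poly_Mapping.lookup (f (leading V g)) m = (\<Sum>i\<in>?I. Poly_Mapping.lookup (f (monom (mpow i 1, drop1 i g) (dsign V i g))) m)"
    using fs[of ?I] by (simp add: leading_def lookup_sum)
  \<comment> \<open>\<open>ksign\<close> includes the sign in front of \<open>f \<circ> D\<close>,
    so a factor \<open>sg (q + 1)\<close> shows up here and cancels against that sign at the
    end.\<close>
  also have "\<dots> = (\<Sum>i\<in>?I. if 0 < m i then sg (q + 1) * ksign V q i m g * coef f (drop1 i m) (drop1 i g) else 0)"
  proof (intro sum.cong refl)
    fix i assume i: "i \<in> ?I"
    have "sg (q + 1) * ksign V q i m g = dsign V i g * sg (q * int (V ! i)) * lam_coeff V (mpow i 1) (drop1 i m)" if "0 < m i"
    proof -
      have "lam_coeff V (mpow i 1) (drop1 i m) = sg (int (V ! i) * (\<Sum>j<i. int (m j) * int (V ! j)))"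
        using lam_coeff_gen[OF m(1) that] i by simp
      then show ?thesis by (simp only: ksign_def dsign_def sg_add) (simp add: mult_ac sg_def)
    qed
    then show "Poly_Mapping.lookup (f (monom (mpow i 1, drop1 i g) (dsign V i g))) m =
       (if 0 < m i then sg (q + 1) * ksign V q i m g * coef f (drop1 i m) (drop1 i g) else 0)"
      using i g lookup_lmult_gen[OF m(1), of i] Hom_deg_single[OF fH, of "mpow i 1" "drop1 i g" "dsign V i g"]
      by (simp add: coef_def mult_ac)
  qed
  also have "\<dots> = (\<Sum>i | i < length V \<and> 0 < m i \<and> 0 < g i. sg (q + 1) * (ksign V q i m g * coef f (drop1 i m) (drop1 i g)))"
    by (intro sum.mono_neutral_cong_right) (auto simp: mult_ac)
  also have "\<dots> = sg (q + 1) * koszul V q (coef f) m g"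
    by (simp add: koszul_def sum_distrib_left)
  finally have 3: "Poly_Mapping.lookup (f (leading V g)) m = sg (q + 1) * koszul V q (coef f) m g" .
  have "D (monom (mone, g) 1) = leading V g + R" by (simp add: R_def)
  then have "f (D (monom (mone, g) 1)) = f (leading V g) + f R"
    using Hom_lin(2)[OF fH LG] by simp
  then show ?thesis using 1 2 3 by (simp add: coef_def[of "Hom_diff d D q f"] Hom_diff_sg lookup_add)
qed

lemma Hom_diff_Filt:
  assumes f: "f \<in> Filt V p q"
  shows "Hom_diff d D q f \<in> Filt V (p + 1) (q + 1)"
proof -
  note fH = Filt_Hom[OF f]
  have "Hom_diff d D q f (monom (mone, g) 1) \<in> Lam_ge V (p + 1)" if g: "g \<in> mons (susp V)" for g
  proof -
    have "leading V g \<in> remainder V 0" "D (monom (mone, g) 1) - leading V g \<in> remainder V 0"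
      using remainder_mono leading_remainder[OF g] D_leading[OF g] by blast+
    from remainder_add[OF this] have "D (monom (mone, g) 1) \<in> remainder V (0 + 1)"
      by (fastforce simp: remainder_def)
    \<comment> \<open>Shifting the filtration index down by one makes \<open>N = 0\<close>
      admissible, so that the estimate only needs one factor from \<open>V\<close> in each
      term.\<close>
    moreover have "f \<in> Filt V (p - 1) q" using f by (rule Filt_mono) simp
    moreover have "vanish V (p - 1) 0 f" by (rule Filt_vanish[of _ _ _ q]) (use f in simp)
    ultimately have "f (D (monom (mone, g) 1)) \<in> Lam_ge V (p - 1 + 2)"
      using Hom_remainder by blast
    then have "f (D (monom (mone, g) 1)) \<in> Lam_ge V (p + 1)" by (simp add: add.commute)
    moreover have "d (f (monom (mone, g) 1)) \<in> Lam_ge V (p + 1)"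
      using d_ge f g by (simp add: Filt_iff)
    ultimately show ?thesis by (simp add: Hom_diff_sg lam_ge_simps)
  qed
  then show ?thesis using Hom_diff_Hom[OF fH] by (simp add: Filt_iff)
qed

end

lemma bump_madd: "bump i m = madd (mpow i 1) m"
  by (auto simp: bump_def madd_def mpow_def)

lemma wlen_bump [simp]: "i < length V \<Longrightarrow> wlen V (bump i m) = Suc (wlen V m)"
  by (simp add: bump_madd)

lemma mdeg_bump [simp]: "i < length V \<Longrightarrow> mdeg V (bump i m) = V ! i + mdeg V m"
  by (simp add: bump_madd)

lemma wlen_drop1: "i < length V \<Longrightarrow> 0 < m i \<Longrightarrow> wlen V m = Suc (wlen V (drop1 i m))"
  by (metis bump_drop1 wlen_bump)

lemma lookup_monom_sum:
  assumes "finite M"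
  shows "Poly_Mapping.lookup (\<Sum>m\<in>M. monom m (c m)) k = (if k \<in> M then c k else 0)"
  using assms by (simp add: lookup_sum lookup_single when_def)

section \<open>Convergence of the spectral sequence\<close>

context minimal_closure
begin

text \<open>For \<open>N = n + 1 > n0\<close> the layer \<open>u\<close> of \<open>f\<close> in word
  lengths \<open>(p, n)\<close> is a Koszul cycle, because its image is the part of
  \<open>\<D>f\<close> in \<open>(p + 1, n + 1)\<close>, which vanishes by
  \<open>n + 1 > n0\<close>. A Koszul primitive in \<open>(p - 1, n - 1)\<close> extends to a module
  map whose boundary removes this layer. The case \<open>n0 = 0\<close> pushes \<open>f\<close> into
  the next filtration step; a positive \<open>n0\<close> handles maps whose differential is
  controlled only beyond a certain length. The bound \<open>N - 1\<close> on the correction records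
  that it sits one length lower.\<close>

lemma reduce:
  assumes "f \<in> Filt V p q" "p \<noteq> int (wlen V (omega_lam V))"
    and "vanish V (p + 1) (n0 + 1) (Hom_diff d D q f)" "vanish V p N f"
  shows "\<exists>h\<in>Filt V (p - 1) (q - 1). vanish V (p - 1) (N - 1) h \<and>
     (\<lambda>x. f x - Hom_diff d D (q - 1) h x) \<in> Filt V p q \<and>
     vanish V p n0 (\<lambda>x. f x - Hom_diff d D (q - 1) h x)"
  using assms
proof (induction N arbitrary: f)
  case 0
  have "Hom_diff d D (q - 1) (\<lambda>x. 0) x = 0" for x
    by (simp add: Hom_diff_sg)
  moreover have "vanish V (p - 1) (0 - 1) (\<lambda>x. 0)" by (simp add: vanish_def lam_ge_simps)
  ultimately show ?case
    using 0 vanish_mono[OF 0(4), of n0] by (intro bexI[OF _ Filt_zero]) auto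
next
  case (Suc n)
  note f = Suc.prems(1) and fH = Filt_Hom[OF Suc.prems(1)]
  show ?case
  proof (cases "Suc n \<le> n0")
    case True
    have "Hom_diff d D (q - 1) (\<lambda>x. 0) x = 0" for x
      by (simp add: Hom_diff_sg)
    moreover have "vanish V (p - 1) (Suc n - 1) (\<lambda>x. 0)" by (simp add: vanish_def lam_ge_simps)
    ultimately show ?thesis
      using f vanish_mono[OF Suc.prems(4), of n0] True by (intro bexI[OF _ Filt_zero]) auto
  next
    case False
    define u where "u m g = (if (m, g) \<in> cells V \<and> int (wlen V m) = p \<and> wlen V g = n then coef f m g else 0)" for m g
    have cyc: "koszul V q u m g = 0" if c: "(m, g) \<in> cells V" for m g
    proof (cases "int (wlen V m) = p + 1 \<and> wlen V g = Suc n")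
      case True
      have mg: "m \<in> mons V" "g \<in> mons (susp V)" using c by (auto simp: cells_def)
      have "koszul V q u m g = koszul V q (coef f) m g"
        unfolding koszul_def
      proof (intro sum.cong refl)
        fix i assume i: "i \<in> {i. i < length V \<and> 0 < m i \<and> 0 < g i}"
        then have "u (drop1 i m) (drop1 i g) = coef f (drop1 i m) (drop1 i g)"
          using True cells_drop1[OF c] wlen_drop1[of i V m] wlen_drop1[of i V g] by (simp add: u_def)
        then show "ksign V q i m g * u (drop1 i m) (drop1 i g) = ksign V q i m g * coef f (drop1 i m) (drop1 i g)"
          by simp
      qed
      also have "\<dots> = coef (Hom_diff d D q f) m g"
        by (rule Hom_diff_coef[OF f Suc.prems(4), symmetric]) (use mg True in auto)
      also have "\<dots> = 0"
        by (rule vanish_coef[OF Suc.prems(3)]) (use mg True False in auto)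
      finally show ?thesis .
    next
      case False
      have "u (drop1 i m) (drop1 i g) = 0" if "i < length V" "0 < m i" "0 < g i" for i
        using False that wlen_drop1[of i V m] wlen_drop1[of i V g] by (auto simp: u_def)
      then show ?thesis by (auto simp: koszul_def intro!: sum.neutral)
    qed
    have om: "u (omega_lam V) (omega_gam V) = 0" using Suc.prems(2) by (auto simp: u_def)
    obtain v where v: "\<And>m g. (m, g) \<in> cells V \<Longrightarrow> koszul V (q - 1) v m g = u m g"
      and vs: "\<And>m g. v m g \<noteq> 0 \<Longrightarrow>
        \<exists>i<length V. (bump i m, bump i g) \<in> cells V \<and> u (bump i m) (bump i g) \<noteq> 0"
      using koszul_exact[of V q u, OF cyc V1 om] by blast
    have vsupp: "int (wlen V m) = p - 1 \<and> Suc (wlen V g) = n \<and> m \<in> mons V \<and>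
        int (mdeg V m) = int (mdeg (susp V) g) + (q - 1)" if nz: "v m g \<noteq> 0" for m g
    proof -
      obtain i where i: "i < length V" "(bump i m, bump i g) \<in> cells V" "u (bump i m) (bump i g) \<noteq> 0"
        using vs[OF nz] by blast
      then have *: "coef f (bump i m) (bump i g) \<noteq> 0" "int (wlen V (bump i m)) = p" "wlen V (bump i g) = n"
        by (auto simp: u_def split: if_splits)
      have b: "bump i m \<in> mons V" "bump i g \<in> mons (susp V)" using i by (auto simp: cells_def)
      have "m \<in> mons V" using mons_drop1[OF b(1), of i] by simp
      moreover have "2 \<le> V ! i" using V2 i by simp
      moreover have "int (mdeg V (bump i m)) = int (mdeg (susp V) (bump i g)) + q"
        by (rule coef_degree[OF fH b(2) *(1)])
      ultimately show ?thesis using * i(1) by auto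
    qed
    \<comment> \<open>Only has to contain the support of each \<open>v _ g\<close>. For
      \<open>p < 1\<close> the value \<open>nat (p - 1)\<close> is a harmless default, as
      \<open>v\<close> is then zero.\<close>
    define M where "M = {m \<in> mons V. wlen V m = nat (p - 1)}"
    have M: "finite M" unfolding M_def by (rule finite_wlen)
    define F where "F g = (\<Sum>m\<in>M. monom m (v m g))" for g
    have "m \<in> M" if "v m g \<noteq> 0" for m g
      using vsupp[OF that] unfolding M_def by (metis (mono_tags, lifting) mem_Collect_eq nat_int)
    then have lF: "Poly_Mapping.lookup (F g) m = v m g" for m g
      unfolding F_def lookup_monom_sum[OF M] by auto
    have FL: "F g \<in> Lam_ge V (p - 1)" for g
      using vsupp by (auto simp: Lam_ge_def Lam_def in_keys_iff lF)
    define h where "h = extend V (q - 1) F"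
    have h1: "h (monom (mone, g) 1) = F g" for g
      unfolding h_def by (rule extend_one) (rule lam_ge_Lam[OF FL])
    have hH: "h \<in> Hom_deg V (q - 1)"
      unfolding h_def by (rule extend_Hom) (use vsupp in \<open>auto simp: lhomog_def in_keys_iff lF\<close>)
    have hF: "h \<in> Filt V (p - 1) (q - 1)" using hH FL by (simp add: Filt_iff h1)
    have ch: "coef h m g = v m g" for m g by (simp add: coef_def h1 lF)
    \<comment> \<open>Since \<open>v\<close> lives in length \<open>n - 1\<close>, the Koszul
      formula for the boundary of \<open>h\<close> is valid from length \<open>n\<close> on, exactly
      the layer to be removed.\<close>
    have hv: "vanish V (p - 1) n h"
      by (rule vanishI[OF hF]) (use vsupp ch in fastforce)
    let ?f = "\<lambda>x. f x - Hom_diff d D (q - 1) h x"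
    have Dh: "Hom_diff d D (q - 1) h \<in> Filt V p q" using Hom_diff_Filt[OF hF] by simp
    have f': "?f \<in> Filt V p q" by (rule Filt_diff[OF f Dh])
    have fv: "vanish V p n ?f"
    proof (rule vanishI[OF f'])
      fix m g assume a: "m \<in> mons V" "g \<in> mons (susp V)" "int (wlen V m) = p" "n \<le> wlen V g"
      have c: "(m, g) \<in> cells V" using a by (simp add: cells_def)
      have "coef (Hom_diff d D (q - 1) h) m g = koszul V (q - 1) (coef h) m g"
        by (rule Hom_diff_coef[OF hF hv]) (use a in auto)
      also have "\<dots> = u m g" using v[OF c] by (simp add: koszul_def ch)
      finally have "coef ?f m g = coef f m g - u m g" by (simp add: coef_def lookup_minus)
      also have "\<dots> = 0"
      proof (cases "wlen V g = n")
        case False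
        then have "coef f m g = 0" using a by (intro vanish_coef[OF Suc.prems(4)]) auto
        then show ?thesis using False by (simp add: u_def)
      qed (use a c in \<open>simp add: u_def\<close>)
      finally show "coef ?f m g = 0" .
    qed
    have Df: "Hom_diff d D q ?f x = Hom_diff d D q f x" if "x \<in> LamGam V" for x
      using Hom_diff_minus[OF fH Filt_Hom[OF Dh] that] Hom_diff_square[OF hH that] by simp
    have "vanish V (p + 1) (n0 + 1) (Hom_diff d D q ?f)"
      by (rule vanish_cong[OF Suc.prems(3)]) (rule Df)
    from Suc.IH[OF f' Suc.prems(2) this fv] obtain h' where
      h': "h' \<in> Filt V (p - 1) (q - 1)" "vanish V (p - 1) (n - 1) h'"
        "(\<lambda>x. ?f x - Hom_diff d D (q - 1) h' x) \<in> Filt V p q"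
        "vanish V p n0 (\<lambda>x. ?f x - Hom_diff d D (q - 1) h' x)" by blast
    have eq: "f x - Hom_diff d D (q - 1) (\<lambda>x. h x + h' x) x = ?f x - Hom_diff d D (q - 1) h' x"
      if "x \<in> LamGam V" for x
      using Hom_diff_add[OF hH Filt_Hom[OF h'(1)] that] by simp
    show ?thesis
    proof (intro bexI[of _ "\<lambda>x. h x + h' x"] conjI)
      show "vanish V (p - 1) (Suc n - 1) (\<lambda>x. h x + h' x)"
        using vanish_add[OF hv vanish_mono[OF h'(2)]] by simp
      show "(\<lambda>x. f x - Hom_diff d D (q - 1) (\<lambda>x. h x + h' x) x) \<in> Filt V p q"
        by (rule Filt_cong[OF h'(3)]) (rule eq)
      show "vanish V p n0 (\<lambda>x. f x - Hom_diff d D (q - 1) (\<lambda>x. h x + h' x) x)"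
        by (rule vanish_cong[OF h'(4)]) (rule eq)
    qed (rule Filt_add[OF hF h'(1)])
  qed
qed

lemma reduce_Filt:
  assumes f: "f \<in> Filt V p q" and p: "p \<noteq> int (wlen V (omega_lam V))"
    and Df: "Hom_diff d D q f \<in> Filt V (p + 2) (q + 1)" and N: "vanish V p N f"
  shows "\<exists>h\<in>Filt V (p - 1) (q - 1). vanish V (p - 1) (N - 1) h \<and>
    (\<lambda>x. f x - Hom_diff d D (q - 1) h x) \<in> Filt V (p + 1) q"
proof -
  have "vanish V (p + 1) (0 + 1) (Hom_diff d D q f)"
    by (rule Filt_vanish[of _ _ _ "q + 1"]) (use Df in \<open>simp add: add.assoc\<close>)
  from reduce[OF f p this N] show ?thesis using vanish_0 Filt_Hom by blast
qed

lemma omega_cell: "omega_lam V \<in> mons V" "omega_gam V \<in> mons (susp V)"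
  using V1 by (auto simp: mons_def omega_lam_def omega_gam_def)

lemma Z_inf_B_inf:
  assumes p: "p \<noteq> int (wlen V (omega_lam V))"
  shows "Z_inf V d D p q \<subseteq> B_inf V d D p q"
proof
  fix f assume "f \<in> Z_inf V d D p q"
  then have f: "f \<in> Filt V p q" and "\<exists>z\<in>approx_cycles V d D 2 p q. (\<lambda>x. f x - z x) \<in> Filt V (p + 1) q"
    unfolding Z_inf_def by blast+
  then obtain z where z: "z \<in> Filt V p q" "Hom_diff d D q z \<in> Filt V (p + 2) (q + 1)"
    "(\<lambda>x. f x - z x) \<in> Filt V (p + 1) q" by (auto simp: approx_cycles_def)
  obtain N where "vanish V p N z" using vanish_exists[OF z(1) V2] by blast
  from reduce_Filt[OF z(1) p z(2) this] obtain h where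
    h: "h \<in> Filt V (p - 1) (q - 1)" "(\<lambda>x. z x - Hom_diff d D (q - 1) h x) \<in> Filt V (p + 1) q" by blast
  have "(\<lambda>x. f x - Hom_diff d D (q - 1) h x) \<in> Filt V (p + 1) q"
    using Filt_add[OF z(3) h(2)] by simp
  moreover have "h \<in> approx_cycles V d D 1 (p - int 1) (q - 1)"
    using h(1) Hom_diff_Filt[OF h(1)] by (simp add: approx_cycles_def)
  ultimately show "f \<in> B_inf V d D p q" using f unfolding B_inf_def by blast
qed

text \<open>The dual class \<open>w\<close> is only a Koszul cycle: the other terms may leave
  something of \<open>\<D>w\<close> in word length one higher, but only on monomials no longer than
  \<open>omega_gam\<close>. As \<open>\<D>w\<close> is a cycle in another filtration degree, some
  \<open>h\<close> corrects it, and by the bound \<open>N - 1\<close> this \<open>h\<close> vanishes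
  at \<open>omega_gam\<close>. Hence \<open>w - h\<close> keeps the coefficient 1.\<close>

lemma dual_class:
  obtains f q where "f \<in> Filt V (int (wlen V (omega_lam V))) q"
    and "vanish V (int (wlen V (omega_lam V))) (wlen V (omega_gam V) + 1) f"
    and "coef f (omega_lam V) (omega_gam V) = 1"
    and "Hom_diff d D q f \<in> Filt V (int (wlen V (omega_lam V)) + 2) (q + 1)"
proof -
  let ?m = "int (wlen V (omega_lam V))" and ?n = "wlen V (omega_gam V)"
  define q where "q = int (mdeg V (omega_lam V)) - int (mdeg (susp V) (omega_gam V))"
  define F where "F g = (if g = omega_gam V then monom (omega_lam V) 1 else 0)" for g
  define w where "w = extend V q F"
  have FL: "F g \<in> Lam_ge V ?m" for g
    using omega_cell by (auto simp: F_def Lam_ge_def)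
  have w1: "w (monom (mone, g) 1) = F g" for g
    unfolding w_def by (rule extend_one) (rule lam_ge_Lam[OF FL])
  have "w \<in> Hom_deg V q"
    unfolding w_def by (rule extend_Hom) (auto simp: F_def lhomog_def q_def)
  then have w: "w \<in> Filt V ?m q" using FL by (simp add: Filt_iff w1)
  have cw: "coef w m g = (if m = omega_lam V \<and> g = omega_gam V then 1 else 0)" for m g
    by (auto simp: coef_def w1 F_def lookup_single when_def)
  have wv: "vanish V ?m (?n + 1) w" by (rule vanishI[OF w]) (auto simp: cw)
  note Dw = Hom_diff_Filt[OF w]
  have Dwv: "vanish V (?m + 1) (?n + 1) (Hom_diff d D q w)"
  proof (rule vanishI[OF Dw])
    fix m g assume a: "m \<in> mons V" "g \<in> mons (susp V)" "int (wlen V m) = ?m + 1" "?n + 1 \<le> wlen V g"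
    have "coef w (drop1 i m) (drop1 i g) = 0" if i: "i < length V" "0 < m i" "0 < g i" for i
    proof (rule ccontr)
      assume "\<not> ?thesis"
      then have *: "drop1 i m = omega_lam V" "drop1 i g = omega_gam V" by (auto simp: cw split: if_splits)
      have "m = bump i (omega_lam V)" "g = bump i (omega_gam V)"
        using bump_drop1[of m i] bump_drop1[of g i] i * by auto
      moreover have "1 \<le> V ! i" using V1 i by simp
      ultimately show False using a(1,2) i
        by (cases "odd (V ! i)") (auto simp: mons_def bump_def omega_lam_def omega_gam_def)
    qed
    then have "koszul V q (coef w) m g = 0" by (auto simp: koszul_def intro!: sum.neutral)
    then show "coef (Hom_diff d D q w) m g = 0"
      using a by (subst Hom_diff_coef[OF w wv]) auto
  qed
  have DDw: "Hom_diff d D (q + 1) (Hom_diff d D q w) \<in> Filt V (?m + 1 + 2) (q + 1 + 1)"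
    by (rule Filt_cong[OF Filt_zero]) (rule Hom_diff_square[OF Filt_Hom[OF w]])
  obtain h where h: "h \<in> Filt V ?m q" "vanish V ?m ?n h"
    "(\<lambda>x. Hom_diff d D q w x - Hom_diff d D q h x) \<in> Filt V (?m + 2) (q + 1)"
    using reduce_Filt[OF Dw _ DDw Dwv] by (auto simp: add.assoc)
  let ?f = "\<lambda>x. w x - h x"
  have "?f \<in> Filt V ?m q" by (rule Filt_diff[OF w h(1)])
  moreover have "vanish V ?m (?n + 1) ?f"
    by (rule vanishI[OF calculation])
       (use vanish_coef[OF wv] vanish_coef[OF h(2)] in \<open>auto simp: coef_def lookup_minus\<close>)
  moreover have "coef ?f (omega_lam V) (omega_gam V) = 1"
  proof -
    have "coef h (omega_lam V) (omega_gam V) = 0"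
      using omega_cell by (intro vanish_coef[OF h(2)]) auto
    then show ?thesis using cw[of "omega_lam V" "omega_gam V"] by (simp add: coef_def lookup_minus)
  qed
  moreover have "Hom_diff d D q ?f \<in> Filt V (?m + 2) (q + 1)"
    by (rule Filt_cong[OF h(3)]) (rule Hom_diff_minus[OF Filt_Hom[OF w] Filt_Hom[OF h(1)]])
  ultimately show ?thesis using that by blast
qed

text \<open>The obstruction \<open>\<D>z\<close> is a cycle in filtration degree above
  \<open>m\<close>, hence a boundary modulo the next step. The correction lies in
  \<open>F^(m+1)\<close>, so the class of \<open>f\<close> in \<open>F^m/F^(m+1)\<close> does not
  change.\<close>

lemma lift_cycle:
  assumes f: "f \<in> Filt V m q" "Hom_diff d D q f \<in> Filt V (m + 2) (q + 1)"
    and m: "m = int (wlen V (omega_lam V))"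
  shows "\<exists>z\<in>Filt V m q. (\<lambda>x. f x - z x) \<in> Filt V (m + 1) q \<and>
     Hom_diff d D q z \<in> Filt V (m + 2 + int r) (q + 1)"
proof (induction r)
  case 0
  show ?case using f Filt_zero by (intro bexI[of _ f]) auto
next
  case (Suc r)
  then obtain z where z: "z \<in> Filt V m q" "(\<lambda>x. f x - z x) \<in> Filt V (m + 1) q"
    "Hom_diff d D q z \<in> Filt V (m + 2 + int r) (q + 1)" by blast
  let ?p = "m + 2 + int r"
  have sq: "Hom_diff d D (q + 1) (Hom_diff d D q z) \<in> Filt V (?p + 2) (q + 1 + 1)"
    by (rule Filt_cong[OF Filt_zero]) (rule Hom_diff_square[OF Filt_Hom[OF z(1)]])
  obtain N where N: "vanish V ?p N (Hom_diff d D q z)" using vanish_exists[OF z(3) V2] by blast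
  have "?p \<noteq> int (wlen V (omega_lam V))" using m by simp
  from reduce_Filt[OF z(3) this sq N] obtain h where
    h: "h \<in> Filt V (?p - 1) q" "(\<lambda>x. Hom_diff d D q z x - Hom_diff d D q h x) \<in> Filt V (?p + 1) (q + 1)"
    by auto
  have h': "h \<in> Filt V m q" "h \<in> Filt V (m + 1) q" using h(1) by (auto elim: Filt_mono)
  show ?case
  proof (intro bexI[of _ "\<lambda>x. z x - h x"] conjI)
    show "(\<lambda>x. f x - (z x - h x)) \<in> Filt V (m + 1) q"
      using Filt_add[OF z(2) h'(2)] by (simp add: algebra_simps)
    have "Hom_diff d D q (\<lambda>x. z x - h x) \<in> Filt V (?p + 1) (q + 1)"
      by (rule Filt_cong[OF h(2)]) (rule Hom_diff_minus[OF Filt_Hom[OF z(1)] Filt_Hom[OF h(1)]])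
    then show "Hom_diff d D q (\<lambda>x. z x - h x) \<in> Filt V (m + 2 + int (Suc r)) (q + 1)"
      by (simp add: algebra_simps)
  qed (rule Filt_diff[OF z(1) h'(1)])
qed

text \<open>\<open>h\<close> is pushed up the filtration by subtracting boundaries, which does not
  affect \<open>\<D>h\<close>. From degree \<open>m - 2\<close> or below this works because
  \<open>\<D>h \<in> F^m\<close>. In degree \<open>m - 1\<close> it can be done only on lengths from
  that of \<open>omega_gam\<close> on, and there the Koszul formula contradicts the coefficient 1.
  Once \<open>h\<close> is in \<open>F^m\<close>, its boundary is in \<open>F^(m+1)\<close>, and so
  would be \<open>f\<close>.\<close>

lemma not_boundary:
  assumes f: "vanish V m (wlen V (omega_gam V) + 1) f" "coef f (omega_lam V) (omega_gam V) = 1"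
      "f \<in> Filt V m q"
    and m: "m = int (wlen V (omega_lam V))"
    and "h \<in> Filt V (m - int r) (q - 1)"
    and "(\<lambda>x. f x - Hom_diff d D (q - 1) h x) \<in> Filt V (m + 1) q"
  shows False
  using assms(5,6)
proof (induction r arbitrary: h)
  case 0
  have "Hom_diff d D (q - 1) h \<in> Filt V (m + 1) q" using Hom_diff_Filt[OF 0(1)] by simp
  from Filt_add[OF 0(2) this] have "f \<in> Filt V (m + 1) q" by simp
  then have "vanish V m 0 f" by (rule Filt_vanish)
  from vanish_coef[OF this omega_cell(2), of "omega_lam V"] show False using f m by simp
next
  case (Suc r)
  note h = Suc.prems(1)
  let ?p = "m - int (Suc r)" and ?n = "wlen V (omega_gam V)"
  have pm: "?p \<noteq> int (wlen V (omega_lam V))" using m by simp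
  obtain N where N: "vanish V ?p N h" using vanish_exists[OF h V2] by blast
  have Dh: "coef (Hom_diff d D (q - 1) h) a g = coef f a g"
    if "g \<in> mons (susp V)" "int (wlen V a) \<le> m" for a g
  proof -
    have "coef (\<lambda>x. f x - Hom_diff d D (q - 1) h x) a g = 0"
      by (rule vanish_coef[OF Filt_vanish[OF Suc.prems(2)], of _ 0]) (use that in auto)
    then show ?thesis by (simp add: coef_def lookup_minus)
  qed
  have DhF: "Hom_diff d D (q - 1) h \<in> Filt V m q"
    using Filt_diff[OF f(3) Filt_mono[OF Suc.prems(2)]] by simp
  have subst: "(\<lambda>x. f x - Hom_diff d D (q - 1) (\<lambda>x. h x - Hom_diff d D (q - 1 - 1) h' x) x) \<in> Filt V (m + 1) q"
    if h': "h' \<in> Filt V (?p - 1) (q - 1 - 1)" for h'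
  proof (rule Filt_cong[OF Suc.prems(2)])
    fix x assume x: "x \<in> LamGam V"
    have "Hom_diff d D (q - 1 - 1) h' \<in> Hom_deg V (q - 1)" using Hom_diff_Hom[OF Filt_Hom[OF h']] by simp
    from Hom_diff_minus[OF Filt_Hom[OF h] this x] Hom_diff_square[OF Filt_Hom[OF h'] x]
    show "f x - Hom_diff d D (q - 1) (\<lambda>x. h x - Hom_diff d D (q - 1 - 1) h' x) x = f x - Hom_diff d D (q - 1) h x"
      by simp
  qed
  show False
  proof (cases r)
    case 0
    have "vanish V m (?n + 1) (Hom_diff d D (q - 1) h)"
    proof (rule vanishI[OF DhF])
      fix a g assume a: "a \<in> mons V" "g \<in> mons (susp V)" "int (wlen V a) = m" "?n + 1 \<le> wlen V g"
      then show "coef (Hom_diff d D (q - 1) h) a g = 0"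
        using Dh[of g a] vanish_coef[OF f(1) a(2,4), of a] by simp
    qed
    then have "vanish V (?p + 1) (?n + 1) (Hom_diff d D (q - 1) h)" using 0 by simp
    \<comment> \<open>Here \<open>n0\<close> is the length of \<open>omega_gam\<close>:
      \<open>\<D>h\<close> agrees with \<open>f\<close> modulo \<open>F^(m+1)\<close> and thus
      vanishes only beyond that length.\<close>
    from reduce[OF h pm this N] obtain h' where h': "h' \<in> Filt V (?p - 1) (q - 1 - 1)"
      "(\<lambda>x. h x - Hom_diff d D (q - 1 - 1) h' x) \<in> Filt V ?p (q - 1)"
      "vanish V ?p ?n (\<lambda>x. h x - Hom_diff d D (q - 1 - 1) h' x)" by blast
    let ?h = "\<lambda>x. h x - Hom_diff d D (q - 1 - 1) h' x"
    have "coef (\<lambda>x. f x - Hom_diff d D (q - 1) ?h x) (omega_lam V) (omega_gam V) = 0"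
      by (rule vanish_coef[OF Filt_vanish[OF subst[OF h'(1)]], of _ 0]) (use m omega_cell in auto)
    then have "coef (Hom_diff d D (q - 1) ?h) (omega_lam V) (omega_gam V) = 1"
      using f(2) by (simp add: coef_def lookup_minus)
    moreover have "coef (Hom_diff d D (q - 1) ?h) (omega_lam V) (omega_gam V)
        = koszul V (q - 1) (coef ?h) (omega_lam V) (omega_gam V)"
      by (rule Hom_diff_coef[OF h'(2,3)]) (use 0 m omega_cell in auto)
    \<comment> \<open>An empty sum: \<open>omega_lam\<close> involves only odd generators and
      \<open>omega_gam\<close> only even ones.\<close>
    moreover have "koszul V (q - 1) (coef ?h) (omega_lam V) (omega_gam V) = 0"
      by (auto simp: koszul_def omega_lam_def omega_gam_def intro!: sum.neutral split: if_splits)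
    ultimately show False by simp
  next
    case (Suc r')
    have "Hom_diff d D (q - 1) h \<in> Filt V (?p + 2) (q - 1 + 1)"
      using Filt_mono[OF DhF, of "?p + 2"] Suc by simp
    from reduce_Filt[OF h pm this N] obtain h' where h': "h' \<in> Filt V (?p - 1) (q - 1 - 1)"
      "(\<lambda>x. h x - Hom_diff d D (q - 1 - 1) h' x) \<in> Filt V (?p + 1) (q - 1)" by blast
    have "(\<lambda>x. h x - Hom_diff d D (q - 1 - 1) h' x) \<in> Filt V (m - int r) (q - 1)"
      using h'(2) by (simp add: algebra_simps)
    from Suc.IH[OF this subst[OF h'(1)]] show False .
  qed
qed

lemma E_inf_nonzero_iff: "E_inf_nonzero V d D p \<longleftrightarrow> p = int (wlen V (omega_lam V))"
proof
  assume "E_inf_nonzero V d D p"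
  then show "p = int (wlen V (omega_lam V))" unfolding E_inf_nonzero_def using Z_inf_B_inf by blast
next
  assume p: "p = int (wlen V (omega_lam V))"
  obtain f q where f: "f \<in> Filt V p q" "vanish V p (wlen V (omega_gam V) + 1) f"
    "coef f (omega_lam V) (omega_gam V) = 1" "Hom_diff d D q f \<in> Filt V (p + 2) (q + 1)"
    using dual_class unfolding p by blast
  have "\<exists>z\<in>approx_cycles V d D r p q. (\<lambda>x. f x - z x) \<in> Filt V (p + 1) q" for r
  proof -
    obtain z where z: "z \<in> Filt V p q" "(\<lambda>x. f x - z x) \<in> Filt V (p + 1) q"
      "Hom_diff d D q z \<in> Filt V (p + 2 + int r) (q + 1)"
      using lift_cycle[OF f(1,4) p] by blast
    have "Hom_diff d D q z \<in> Filt V (p + int r) (q + 1)" by (rule Filt_mono[OF z(3)]) simp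
    then show ?thesis using z by (auto simp: approx_cycles_def)
  qed
  then have "f \<in> Z_inf V d D p q" using f(1) by (simp add: Z_inf_def)
  moreover have "f \<notin> B_inf V d D p q"
  proof
    assume "f \<in> B_inf V d D p q"
    then obtain r h where "h \<in> approx_cycles V d D r (p - int r) (q - 1)"
      "(\<lambda>x. f x - Hom_diff d D (q - 1) h x) \<in> Filt V (p + 1) q" by (auto simp: B_inf_def)
    then show False
      using not_boundary[OF f(2,3,1) p] by (auto simp: approx_cycles_def)
  qed
  ultimately show "E_inf_nonzero V d D p" unfolding E_inf_nonzero_def by blast
qed

end

section \<open>Comparison of a differential with its first term\<close>

lemma lookup_wpart: "Poly_Mapping.lookup (wpart V i a) m = (if wlen V m = i then Poly_Mapping.lookup a m else 0)"
  unfolding wpart_def by (subst lookup_monom_sum) (auto simp: in_keys_iff)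

lemma wpart_ge: "a \<in> Lam_ge V p \<Longrightarrow> wpart V i a \<in> Lam_ge V p"
  by (auto simp: Lam_ge_def Lam_def in_keys_iff lookup_wpart split: if_splits)

text \<open>Taking a word length part keeps minimality, so both differentials fit the locale, and
  the column found there is expressed by \<open>V\<close> alone.\<close>

lemma r_inv_first_term:
  assumes V: "\<forall>j\<in>set V. 2 \<le> j" and d: "derivation V d" "\<And>i. i < length V \<Longrightarrow> d (gen i) \<in> Lam_ge V 2"
    and k: "first_term V d k dk" and D: "acyclic_closure V d D" "acyclic_closure V dk Dk"
  shows "r_inv V d D = r_inv V dk Dk"
proof -
  interpret A: minimal_closure V d D
    by unfold_locales (use assms in auto)
  have "derivation V dk" "\<And>i. i < length V \<Longrightarrow> dk (gen i) \<in> Lam_ge V 2"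
    using k wpart_ge[OF d(2)] by (auto simp: first_term_def word_term_def)
  then interpret B: minimal_closure V dk Dk
    by unfold_locales (use V D in auto)
  show ?thesis by (simp add: r_inv_def A.E_inf_nonzero_iff B.E_inf_nonzero_iff)
qed

text \<open>The monomials of \<open>ds (gen i)\<close> are even and those of the difference are not,
  so nothing cancels and \<open>ds (gen i)\<close> is a part of \<open>d (gen i)\<close>.\<close>

lemma pure_differential_ge:
  assumes ds: "pure_differential V d ds" and d: "d (gen i) \<in> Lam_ge V 2" and i: "i < length V"
  shows "ds (gen i) \<in> Lam_ge V 2"
proof (cases "even (V ! i)")
  case True
  then show ?thesis using ds i by (simp add: pure_differential_def lam_ge_simps)
next
  case False
  have "Poly_Mapping.keys (ds (gen i)) \<subseteq> Poly_Mapping.keys (d (gen i))"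
  proof
    fix m assume m: "m \<in> Poly_Mapping.keys (ds (gen i))"
    then have "even_mono V m" using ds i False by (simp add: pure_differential_def)
    then have "m \<notin> Poly_Mapping.keys (d (gen i) - ds (gen i))"
      using ds i False unfolding pure_differential_def by blast
    then show "m \<in> Poly_Mapping.keys (d (gen i))" using m by (simp add: in_keys_iff lookup_minus)
  qed
  then show ?thesis using d by (auto simp: Lam_ge_def Lam_def)
qed

theorem proposition1p0p7:
  fixes V :: "nat list" and d :: "lam \<Rightarrow> lam"
  assumes "sullivan_minimal V d"
    and "\<forall>j\<in>set V. 2 \<le> j"
  shows "(\<forall>k dk D Dk. first_term V d k dk \<longrightarrow> acyclic_closure V d D \<longrightarrow> acyclic_closure V dk Dk
            \<longrightarrow> r_inv V d D = r_inv V dk Dk)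
       \<and> (\<forall>ds k dsk D Dk. pure_differential V d ds \<longrightarrow> first_term V ds k dsk
            \<longrightarrow> acyclic_closure V ds D \<longrightarrow> acyclic_closure V dsk Dk
            \<longrightarrow> r_inv V ds D = r_inv V dsk Dk)"
proof -
  have d: "derivation V d" "\<And>i. i < length V \<Longrightarrow> d (gen i) \<in> Lam_ge V 2"
    using assms(1) by (auto simp: sullivan_minimal_def)
  have pure: "derivation V ds \<and> (\<forall>i<length V. ds (gen i) \<in> Lam_ge V 2)"
    if "pure_differential V d ds" for ds
    using that d(2) pure_differential_ge[of V d ds] by (auto simp: pure_differential_def)
  show ?thesis
  proof (intro conjI allI impI)
    fix k dk D Dk
    assume "first_term V d k dk" "acyclic_closure V d D" "acyclic_closure V dk Dk"
    then show "r_inv V d D = r_inv V dk Dk" using r_inv_first_term[OF assms(2) d] by blast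
  next
    fix ds k dsk D Dk
    assume "pure_differential V d ds"
      and "first_term V ds k dsk" "acyclic_closure V ds D" "acyclic_closure V dsk Dk"
    then show "r_inv V ds D = r_inv V dsk Dk"
      using r_inv_first_term[OF assms(2), of ds k dsk D Dk] pure[of ds] by blast
  qed
qed

end
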